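(* Let $(X_n)_{n\in\mathbb{N}}$ be the BST chain and let $X_\infty$ be its limit, with $X_\infty(u)$ denoting $X_\infty(A_u)$ for $u\in\mathbb{V}$. Let $C:(0,1)\to\mathbb{R}$ be defined by $$C(s):=1+2\bigl(s\log(s)+(1-s)\log(1-s)\bigr).$$ (a) The limit $$Y_\infty:=\sum_{u\in\mathbb{V}}X_\infty(u)\,C\!\left(\frac{X_\infty(u0)}{X_\infty(u)}\right):=\lim_{k\to\infty}\ \sum_{u\in\mathbb{V},\,|u|\le k}X_\infty(u)\,C\!\left(\frac{X_\infty(u0)}{X_\infty(u)}\right)$$ exists almost surely and in quadratic mean. (b) As $n\to\infty$, $$\frac1n\,\mathrm{IPL}(X_n)-2\log n\ \to\ 2\gamma-4+Y_\infty$$ almost surely and in quadratic mean, where $\gamma$ is Euler's constant.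
   Context: Nodes. $\mathbb{V}=\bigsqcup_{k\ge 0}\{0,1\}^k$ is the set of all finite 0--1 sequences (nodes), $\varnothing$ is the empty sequence, $|u|$ is the length of $u$, and $\partial\mathbb{V}=\{0,1\}^\infty$; $\bar{\mathbb{V}}=\mathbb{V}\cup\partial\mathbb{V}$. For $u=(u_1,\dots,u_k)\in\mathbb{V}$ write $u0=(u_1,\dots,u_k,0)$, and, if $k\ge1$, $\bar u=(u_1,\dots,u_{k-1})$ (the parent). Write $u\le v$ if $u$ is a prefix of $v$ ($v\in\bar{\mathbb{V}}$), $u\wedge v$ for the longest common prefix, and $A_u=\{v\in\partial\mathbb{V}: v\ge u\}$. $\bar{\mathbb{V}}$ is the completion of $\mathbb{V}$ under the metric $d_{\mathbb{V}}(u,v)=2^{-|u\wedge v|}-\frac12(2^{-|u|}+2^{-|v|})$. Binary trees. A binary tree is a prefix-stable set $x\subset\mathbb{V}$ ($u\in x$ and $v\le u$ imply $v\in x$). For a finite nonempty binary tree $x$: $\partial x=\{u\in\mathbb{V}:\bar u\in x,\ u\notin x\}$ is the set of external nodes, $\sigma(x,u)=\#\{v\in x:u\le v\}$, and the internal path length is $\mathrm{IPL}(x)=\sum_{u\in x}|u|$. BST chain. This is the Markov chain $(X_n)_{n\in\mathbb{N}}$ of finite binary trees with $X_1=\{\varnothing\}$ in which, given $X_n$, the tree $X_{n+1}$ is $X_n\cup\{u\}$ with $u$ chosen uniformly at random from the $n+1$ external nodes of $X_n$; it is the sequence of trees produced by the binary search tree algorithm applied to i.i.d. uniform$(0,1)$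 input. Its limit $X_\infty$ is the random probability measure on $\partial\mathbb{V}$ that is the almost sure weak limit, on $(\bar{\mathbb{V}},d_{\mathbb{V}})$, of the uniform distributions on the sets $X_n$; equivalently, almost surely $X_\infty(A_u)=\lim_{n\to\infty}\sigma(X_n,u)/n$ for all $u\in\mathbb{V}$. Almost surely $0<X_\infty(A_{u0})/X_\infty(A_u)<1$ for all $u$. Convergence in quadratic mean is convergence in $L^2$. *)

theory Defs
  imports "HOL-Probability.Probability" "HOL-Library.Sublist"
begin

text \<open>
  Finite nodes are of type \<^typ>\<open>bool list\<close>, with \<^const>\<open>False\<close> for 0 and \<^const>\<open>True\<close> for 1.
  The type \<open>bnode\<close> is the disjoint union of the set of nodes and its boundary, the set of
  infinite 0-1 sequences.
\<close>

datatype bnode = Node "bool list" | End "bool stream"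

fun is_prefix :: "bool list \<Rightarrow> bnode \<Rightarrow> bool" where
  "is_prefix u (Node v) = prefix u v"
| "is_prefix u (End s) = (stake (length u) s = u)"

fun bnode_length :: "bnode \<Rightarrow> enat" where
  "bnode_length (Node u) = enat (length u)"
| "bnode_length (End s) = \<infinity>"

text \<open>The length of the longest common prefix; it is infinite for two equal boundary points.\<close>

definition meet_length :: "bnode \<Rightarrow> bnode \<Rightarrow> enat" where
  "meet_length u v = (SUP w \<in> {w. is_prefix w u \<and> is_prefix w v}. enat (length w))"

text \<open>The function \<open>e \<mapsto> 2\<^sup>-\<^sup>e\<close> on extended naturals.\<close>

fun neg_pow2 :: "enat \<Rightarrow> real" where
  "neg_pow2 (enat k) = (1 / 2) ^ k"
| "neg_pow2 \<infinity> = 0"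

lemma neg_pow2_antimono: "e \<le> f \<Longrightarrow> neg_pow2 f \<le> neg_pow2 e"
  by (cases e; cases f) (auto intro: power_decreasing)

lemma neg_pow2_inj: "neg_pow2 e = neg_pow2 f \<Longrightarrow> e = f"
  by (cases e; cases f) (auto simp: power_one_over)

lemma is_prefix_length: "is_prefix w u \<Longrightarrow> enat (length w) \<le> bnode_length u"
  by (cases u) (auto dest: prefix_length_le)

lemma is_prefix_take: "is_prefix w u \<Longrightarrow> is_prefix (take k w) u"
proof (cases u)
  case (End s)
  assume "is_prefix w u"
  then have "w = stake (length w) s" using End by simp
  then have "take k w = stake (min k (length w)) s" by (metis take_stake min.commute)
  then show ?thesis using End by (simp add: min.commute)
qed (auto intro: prefix_order.trans take_is_prefix)

lemma is_prefix_unique: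
  "is_prefix w u \<Longrightarrow> is_prefix w' u \<Longrightarrow> length w = length w' \<Longrightarrow> w = w'"
  by (cases u) (auto simp: prefix_def append_eq_append_conv)

lemma le_meet_length_iff:
  "enat k \<le> meet_length u v \<longleftrightarrow> (\<exists>w. length w = k \<and> is_prefix w u \<and> is_prefix w v)"
proof
  assume k: "enat k \<le> meet_length u v"
  have "\<exists>w. k \<le> length w \<and> is_prefix w u \<and> is_prefix w v"
  proof (cases k)
    case 0
    then show ?thesis by (intro exI[of _ "[]"]) (cases u; cases v; simp)
  next
    case (Suc j)
    then have "enat j < meet_length u v" using k by (simp add: Suc_ile_eq)
    then show ?thesis unfolding meet_length_def less_SUP_iff using Suc
      by (auto simp: Suc_le_eq)
  qed
  then obtain w where "k \<le> length w" "is_prefix w u" "is_prefix w v" by blast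
  then show "\<exists>w. length w = k \<and> is_prefix w u \<and> is_prefix w v"
    by (intro exI[of _ "take k w"]) (simp add: is_prefix_take)
next
  assume "\<exists>w. length w = k \<and> is_prefix w u \<and> is_prefix w v"
  then show "enat k \<le> meet_length u v"
    unfolding meet_length_def by (auto intro!: SUP_upper)
qed

lemma meet_length_commute: "meet_length u v = meet_length v u"
  unfolding meet_length_def by (simp add: conj_commute)

lemma meet_length_le: "meet_length u v \<le> bnode_length u"
  unfolding meet_length_def by (auto intro!: SUP_least is_prefix_length)

lemma enat_le_by_nat: "(\<And>k. enat k \<le> a \<Longrightarrow> enat k \<le> b) \<Longrightarrow> a \<le> b" for a b :: enat
proof (rule ccontr)
  assume *: "\<And>k. enat k \<le> a \<Longrightarrow> enat k \<le> b" and "\<not> a \<le> b"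
  then have "b < a" by simp
  then obtain m where m: "b = enat m" by (cases b) auto
  with \<open>b < a\<close> have "enat (Suc m) \<le> a" by (simp add: Suc_ile_eq)
  with *[of "Suc m"] m show False by simp
qed

lemma meet_length_ultra: "min (meet_length u v) (meet_length v w) \<le> meet_length u w"
proof (rule enat_le_by_nat)
  fix k assume "enat k \<le> min (meet_length u v) (meet_length v w)"
  then have "enat k \<le> meet_length u v" "enat k \<le> meet_length v w" by auto
  then show "enat k \<le> meet_length u w"
    unfolding le_meet_length_iff by (metis is_prefix_unique)
qed

lemma meet_length_self: "meet_length u u = bnode_length u"
proof (rule antisym[OF meet_length_le], rule enat_le_by_nat)
  fix k assume "enat k \<le> bnode_length u"
  then show "enat k \<le> meet_length u u" unfolding le_meet_length_iff
  proof (cases u)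
    case (Node v)
    with \<open>enat k \<le> bnode_length u\<close> show "\<exists>w. length w = k \<and> is_prefix w u \<and> is_prefix w u"
      by (intro exI[of _ "take k v"]) (auto simp: take_is_prefix)
  next
    case (End s)
    then show "\<exists>w. length w = k \<and> is_prefix w u \<and> is_prefix w u"
      by (intro exI[of _ "stake k s"]) auto
  qed
qed

lemma bnode_eqI:
  assumes "meet_length u v = bnode_length u" "meet_length u v = bnode_length v"
  shows "u = v"
proof (cases u)
  case (Node a)
  with assms obtain b where v: "v = Node b" "length b = length a" by (cases v) auto
  have "enat (length a) \<le> meet_length u v" using assms Node by simp
  then obtain w where "length w = length a" "prefix w a" "prefix w b"
    unfolding le_meet_length_iff using Node v by auto
  then have "w = a" "w = b" using v by (auto simp: prefix_def)
  then show ?thesis using Node v by simp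
next
  case (End s)
  with assms obtain t where t: "v = End t" by (cases v) auto
  have "stake k s = stake k t" for k
  proof -
    have "enat k \<le> meet_length u v" using assms End by simp
    then show ?thesis unfolding le_meet_length_iff using End t by auto
  qed
  then have "s !! n = t !! n" for n by (metis stake_nth lessI)
  then have "s = t" using smap_alt[of id s t] by (simp add: stream.map_id)
  then show ?thesis using End t by simp
qed

instantiation bnode :: metric_space
begin

definition dist_bnode :: "bnode \<Rightarrow> bnode \<Rightarrow> real" where
  "dist_bnode u v =
     neg_pow2 (meet_length u v) - (neg_pow2 (bnode_length u) + neg_pow2 (bnode_length v)) / 2"

definition uniformity_bnode :: "(bnode \<times> bnode) filter" where
  "uniformity_bnode = (INF e \<in> {0<..}. principal {(x, y). dist x y < e})"

definition open_bnode :: "bnode set \<Rightarrow> bool" where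
  "open_bnode U \<longleftrightarrow> (\<forall>x\<in>U. \<forall>\<^sub>F (x', y) in uniformity. x' = x \<longrightarrow> y \<in> U)"

instance
proof
  fix u v w :: bnode
  have le: "neg_pow2 (bnode_length a) \<le> neg_pow2 (meet_length a b)" for a b
    by (intro neg_pow2_antimono meet_length_le)
  show "dist u v = 0 \<longleftrightarrow> u = v"
  proof
    assume "dist u v = 0"
    then have "neg_pow2 (meet_length u v) = neg_pow2 (bnode_length u)"
      "neg_pow2 (meet_length u v) = neg_pow2 (bnode_length v)"
      using le[of u v] le[of v u] meet_length_commute[of u v] unfolding dist_bnode_def by (simp_all add: field_simps)
    then show "u = v" by (intro bnode_eqI neg_pow2_inj)
  qed (simp add: dist_bnode_def meet_length_self)
  have "neg_pow2 (meet_length u v)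
      \<le> max (neg_pow2 (meet_length u w)) (neg_pow2 (meet_length w v))"
    using neg_pow2_antimono[OF meet_length_ultra[of u w v]] by (auto simp: min_def split: if_splits)
  then show "dist u v \<le> dist u w + dist v w"
    using le[of w u] le[of w v] meet_length_commute[of w u] meet_length_commute[of w v]
    unfolding dist_bnode_def by (auto simp: max_def field_simps split: if_splits)
qed (simp_all add: uniformity_bnode_def open_bnode_def)

end

definition boundary :: "bnode set" where
  "boundary = range End"

definition cyl :: "bool list \<Rightarrow> bnode set" where
  "cyl u = {v \<in> boundary. is_prefix u v}"

definition binary_tree :: "bool list set \<Rightarrow> bool" where
  "binary_tree x \<longleftrightarrow> (\<forall>u\<in>x. \<forall>v. prefix v u \<longrightarrow> v \<in> x)"

definition external_nodes :: "bool list set \<Rightarrow> bool list set" where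
  "external_nodes x = {u. u \<noteq> [] \<and> butlast u \<in> x \<and> u \<notin> x}"

definition IPL :: "bool list set \<Rightarrow> nat" where
  "IPL x = (\<Sum>u\<in>x. length u)"

definition bst_step :: "bool list set \<Rightarrow> bool list set pmf" where
  "bst_step x = map_pmf (\<lambda>u. insert u x) (pmf_of_set (external_nodes x))"

text \<open>
  Time starts at 1; \<open>X 0\<close> is irrelevant.  The state space is countable, so the Markov property
  with transition kernel \<^const>\<open>bst_step\<close> is expressed by the probabilities of finite paths.
\<close>

definition bst_chain :: "'a measure \<Rightarrow> (nat \<Rightarrow> 'a \<Rightarrow> bool list set) \<Rightarrow> bool" where
  "bst_chain M X \<longleftrightarrow>
     (\<forall>n\<ge>1. X n \<in> measurable M (count_space {x. finite x \<and> x \<noteq> {} \<and> binary_tree x})) \<and>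
     (AE \<omega> in M. X 1 \<omega> = {[]}) \<and>
     (\<forall>n\<ge>1. \<forall>x :: nat \<Rightarrow> bool list set.
        measure M {\<omega> \<in> space M. \<forall>i\<in>{1..n + 1}. X i \<omega> = x i} =
        measure M {\<omega> \<in> space M. \<forall>i\<in>{1..n}. X i \<omega> = x i} * pmf (bst_step (x n)) (x (n + 1)))"

text \<open>
  Weak convergence on the metric space \<^typ>\<open>bnode\<close> of the uniform distributions on the
  (nonempty, finite) sets \<open>x n\<close> to a measure \<open>\<mu>\<close> on the boundary, by means of bounded continuous
  test functions on the whole of \<^typ>\<open>bnode\<close>.
\<close>

definition unif_weakly_converges :: "(nat \<Rightarrow> bool list set) \<Rightarrow> bnode measure \<Rightarrow> bool" where
  "unif_weakly_converges x \<mu> \<longleftrightarrow>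
     (\<forall>f :: bnode \<Rightarrow> real. continuous_on UNIV f \<longrightarrow> bounded (range f) \<longrightarrow>
        (\<lambda>n. measure_pmf.expectation (pmf_of_set (Node ` x n)) f) \<longlonglongrightarrow> integral\<^sup>L \<mu> f)"

definition bst_limit ::
    "'a measure \<Rightarrow> (nat \<Rightarrow> 'a \<Rightarrow> bool list set) \<Rightarrow> ('a \<Rightarrow> bnode measure) \<Rightarrow> bool" where
  "bst_limit M X Xlim \<longleftrightarrow>
     Xlim \<in> measurable M (prob_algebra (restrict_space borel boundary)) \<and>
     (AE \<omega> in M. unif_weakly_converges (\<lambda>n. X n \<omega>) (Xlim \<omega>))"

text \<open>Only the values for \<open>0 < s < 1\<close> matter.\<close>

definition C :: "real \<Rightarrow> real" where
  "C s = 1 + 2 * (s * ln s + (1 - s) * ln (1 - s))"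

definition Y_part :: "bnode measure \<Rightarrow> nat \<Rightarrow> real" where
  "Y_part \<mu> k = (\<Sum>u | length u \<le> k.
     measure \<mu> (cyl u) * C (measure \<mu> (cyl (u @ [False])) / measure \<mu> (cyl u)))"

definition Y_lim :: "bnode measure \<Rightarrow> real" where
  "Y_lim \<mu> = lim (Y_part \<mu>)"

definition square_integrable :: "'a measure \<Rightarrow> ('a \<Rightarrow> real) \<Rightarrow> bool" where
  "square_integrable M f \<longleftrightarrow> f \<in> borel_measurable M \<and> integrable M (\<lambda>\<omega>. (f \<omega>)\<^sup>2)"

definition converges_L2 :: "'a measure \<Rightarrow> (nat \<Rightarrow> 'a \<Rightarrow> real) \<Rightarrow> ('a \<Rightarrow> real) \<Rightarrow> bool" where
  "converges_L2 M F f \<longleftrightarrow>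
     (\<forall>n. square_integrable M (F n)) \<and> square_integrable M f \<and>
     (\<lambda>n. \<integral>\<omega>. (F n \<omega> - f \<omega>)\<^sup>2 \<partial>M) \<longlonglongrightarrow> 0"

end

(*
  With mean_IPL n = 2 (n + 1) H_n - 4 n and s(u), c(u), d(u) the sizes of the subtrees of x at u, u0, u1,
  the internal path length telescopes along the tree:
    IPL x = mean_IPL |x| + sum over u in x of toll x u,
    toll x u = s(u) - 1 + mean_IPL (c(u)) + mean_IPL (d(u)) - mean_IPL (s(u)).
  For fixed u, toll X_n u / n converges to X_infinity(u) C(X_infinity(u0) / X_infinity(u)), because weak
  convergence gives s(u) / n -> X_infinity(u) and the harmonic numbers turn into logarithms.
  So only the nodes of large depth matter, uniformly in n.  Each toll X_n u / (n + 1) is a martingale, tolls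
  at different nodes are orthogonal, and E (toll X_n u)^2 <= const n^2 3^(-|u|) since a subtree splits
  uniformly.  As there are 2^k nodes of depth k, the nodes deeper than k contribute O((2/3)^k) to the second
  moment of the normalised sum, and by Doob's inequality also to the probability that this contribution is
  ever large.  Borel-Cantelli then gives almost sure convergence of both the series and the path lengths.
*)
theory Submission imports Defs begin

subsection \<open>Trees and tolls\<close>

text \<open>The obstacle is an exchange of limits. Each toll has its limit for a fixed node, while
  the sum runs over infinitely many nodes. A second moment bound on the deep nodes, uniform in n,
  settles quadratic mean only. For single paths the error must be small for all n at once; the
  maximal inequality gives this, and (2/3)^k is summable, as Borel-Cantelli requires. The toll is
  centred by design: given the split of a random subtree, it is the conditional mean of its path
  length minus the unconditional mean. This is where the orthogonality comes from, and it also
  cancels the terms of order s log s. Neither filtrations nor conditional expectations appear. The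
  first n trees have a law with finite support, a conditional expectation is an average over
  external nodes, and a martingale property is an eigenvalue identity for a sum over them. A tree
  has \<open>card x + 1\<close> external nodes, so the eigenvalue \<open>card x + 2\<close> of the
  tolls makes \<open>toll x u / (card x + 1)\<close> a martingale. The identities come from an urn:
  the sizes c, d of the two subtrees below a node grow with weights c + 1 and d + 1. The abstract
  space enters only at the end, through the law of finite paths.\<close>

definition is_tree :: "bool list set \<Rightarrow> bool" where
  "is_tree x \<longleftrightarrow> finite x \<and> x \<noteq> {} \<and> binary_tree x"

text \<open>This is sigma(x, u) of the English statement; it is 0 outside the tree.\<close>

definition fringe_size :: "bool list set \<Rightarrow> bool list \<Rightarrow> nat" where
  "fringe_size x u = card {v\<in>x. prefix u v}"

lemma is_treeD:
  assumes "is_tree x"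
  shows "finite x" and "[] \<in> x" and "u \<in> x \<Longrightarrow> prefix v u \<Longrightarrow> v \<in> x"
  using assms by (auto simp: is_tree_def binary_tree_def)

lemma butlast_mem_tree: "is_tree x \<Longrightarrow> u \<in> x \<Longrightarrow> butlast u \<in> x"
  using is_treeD(3) prefixeq_butlast by blast

lemma prefix_butlast_iff: "w \<noteq> [] \<Longrightarrow> prefix u w \<longleftrightarrow> w = u \<or> prefix u (butlast w)"
  by (cases w rule: rev_cases) auto

lemma is_tree_root: "is_tree {[]}"
  by (auto simp: is_tree_def binary_tree_def)

lemma is_tree_insert:
  assumes "is_tree x" "w \<in> external_nodes x"
  shows "is_tree (insert w x)"
proof -
  have "v \<in> insert w x" if "prefix v w" for v
  proof (cases "v = w")
    case False
    then have "prefix v (butlast w)"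
      using that assms(2) by (auto simp: prefix_butlast_iff external_nodes_def)
    then show ?thesis
      using assms is_treeD(3) by (auto simp: external_nodes_def)
  qed simp
  then show ?thesis
    using assms by (auto simp: is_tree_def binary_tree_def)
qed

lemma external_nodes_subset: "external_nodes x \<subseteq> (\<lambda>(v, b). v @ [b]) ` (x \<times> UNIV)"
proof
  fix w assume "w \<in> external_nodes x"
  then show "w \<in> (\<lambda>(v, b). v @ [b]) ` (x \<times> UNIV)"
    by (intro image_eqI[of _ _ "(butlast w, last w)"]) (auto simp: external_nodes_def)
qed

lemma finite_external_nodes: "finite x \<Longrightarrow> finite (external_nodes x)"
  by (rule finite_subset[OF external_nodes_subset]) simp

lemma fringe_size_notin: "is_tree x \<Longrightarrow> u \<notin> x \<Longrightarrow> fringe_size x u = 0"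
  using is_treeD(3)[of x _ u] unfolding fringe_size_def by (metis (no_types, lifting) card.empty empty_Collect_eq)

lemma fringe_size_root: "fringe_size x [] = card x"
  by (simp add: fringe_size_def)

lemma fringe_size_le: "finite x \<Longrightarrow> fringe_size x u \<le> card x"
  by (auto simp: fringe_size_def intro!: card_mono)

lemma fringe_size_insert:
  assumes "finite x" "w \<notin> x"
  shows "fringe_size (insert w x) u = fringe_size x u + of_bool (prefix u w)"
proof -
  have "{v \<in> insert w x. prefix u v} = (if prefix u w then insert w else id) {v \<in> x. prefix u v}"
    by auto
  then show ?thesis using assms by (simp add: fringe_size_def)
qed

lemma prefix_children: "prefix u v \<longleftrightarrow> v = u \<or> prefix (u @ [False]) v \<or> prefix (u @ [True]) v"
proof
  assume "prefix u v"
  then obtain z where "v = u @ z" by (auto simp: prefix_def)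
  then show "v = u \<or> prefix (u @ [False]) v \<or> prefix (u @ [True]) v"
  proof (cases z)
    case (Cons b z')
    then show ?thesis using \<open>v = u @ z\<close> by (cases b) auto
  qed simp
qed (auto dest: append_prefixD)

lemma not_prefix_both_children: "\<not> (prefix (u @ [b]) v \<and> prefix (u @ [\<not> b]) v)"
  by (auto simp: prefix_def)

lemma fringe_size_split:
  assumes "is_tree x" "u \<in> x"
  shows "fringe_size x u = Suc (fringe_size x (u @ [b]) + fringe_size x (u @ [\<not> b]))"
proof -
  have *: "{v\<in>x. prefix u v} = insert u ({v\<in>x. prefix (u @ [b]) v} \<union> {v\<in>x. prefix (u @ [\<not> b]) v})"
    using assms(2) prefix_children[of u] by (cases b) auto
  show ?thesis
    unfolding fringe_size_def * using is_treeD(1)[OF assms(1)] not_prefix_both_children[of u b]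
    by (subst card_insert_disjoint) (auto intro!: card_Un_disjoint simp: prefix_def)
qed

section \<open>Counting external nodes and the urn of subtree sizes\<close>

text \<open>The s nodes of the subtree have 2 s children. All nodes of the subtree except u are
  among them, and the remaining s + 1 children are external.\<close>

lemma card_external_nodes_above:
  assumes x: "is_tree x" and u: "u \<in> x"
  shows "card {w \<in> external_nodes x. prefix u w} = Suc (fringe_size x u)"
proof -
  let ?S = "{v\<in>x. prefix u v}" and ?E = "{w \<in> external_nodes x. prefix u w}"
  note fin = is_treeD(1)[OF x] finite_external_nodes[OF is_treeD(1)[OF x]]
  have "(\<lambda>(v, b). v @ [b]) ` (?S \<times> UNIV) = (?S - {u}) \<union> ?E"
  proof (intro set_eqI iffI)
    fix w assume "w \<in> (\<lambda>(v, b). v @ [b]) ` (?S \<times> UNIV)"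
    then obtain v b where v: "w = v @ [b]" "v \<in> x" "prefix u v" by auto
    then have "prefix u w" "w \<noteq> u" by auto
    then show "w \<in> (?S - {u}) \<union> ?E"
      using v by (auto simp: external_nodes_def)
  next
    fix w assume w: "w \<in> (?S - {u}) \<union> ?E"
    then have "w \<noteq> u" "prefix u w" using u by (auto simp: external_nodes_def)
    then have "w \<noteq> []" by auto
    then have "prefix u (butlast w)"
      using \<open>prefix u w\<close> \<open>w \<noteq> u\<close> by (simp add: prefix_butlast_iff)
    moreover have "butlast w \<in> x"
      using w butlast_mem_tree[OF x] by (auto simp: external_nodes_def)
    ultimately show "w \<in> (\<lambda>(v, b). v @ [b]) ` (?S \<times> UNIV)"
      using \<open>w \<noteq> []\<close> by (intro image_eqI[of _ _ "(butlast w, last w)"]) auto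
  qed
  moreover have "card ((\<lambda>(v, b). v @ [b]) ` (?S \<times> (UNIV :: bool set))) = 2 * card ?S"
    by (subst card_image) (auto simp: inj_on_def card_cartesian_product)
  moreover have "card ((?S - {u}) \<union> ?E) = card ?S - 1 + card ?E"
    using fin u by (subst card_Un_disjoint) (auto, auto simp: external_nodes_def)
  moreover have "card ?S > 0" using fin u by (auto simp: card_gt_0_iff)
  ultimately show ?thesis by (simp add: fringe_size_def)
qed

text \<open>The parent of an external node lies in x, so a second external node strictly below u
  would put u into x.\<close>

lemma external_nodes_above_external:
  assumes "is_tree x" "u \<in> external_nodes x"
  shows "{w \<in> external_nodes x. prefix u w} = {u}"
proof -
  have "w = u" if "w \<in> external_nodes x" "prefix u w" for w
  proof (rule ccontr)
    assume "w \<noteq> u"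
    then have "prefix u (butlast w)"
      using that by (auto simp: prefix_butlast_iff external_nodes_def)
    then show False
      using assms that is_treeD(3)[OF assms(1)] by (auto simp: external_nodes_def)
  qed
  then show ?thesis using assms by auto
qed

text \<open>An empty child subtree still offers one place for insertion, so the count needs no case
  distinction on the child.\<close>

lemma card_external_nodes_above_child:
  assumes x: "is_tree x" and u: "u \<in> x"
  shows "card {w \<in> external_nodes x. prefix (u @ [b]) w} = Suc (fringe_size x (u @ [b]))"
proof (cases "u @ [b] \<in> x")
  case False
  then have "u @ [b] \<in> external_nodes x" using u by (auto simp: external_nodes_def)
  then show ?thesis
    using external_nodes_above_external[OF x] fringe_size_notin[OF x False] by simp
qed (rule card_external_nodes_above[OF x])

lemma card_external_nodes: "is_tree x \<Longrightarrow> card (external_nodes x) = Suc (card x)"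
  using card_external_nodes_above[of x "[]"] by (simp add: is_treeD(2) fringe_size_root)

text \<open>One step of the urn: the pair (c, d) moves to (c + 1, d) with weight c + 1, to (c, d +
  1) with weight d + 1, and rests with the weight of the external nodes not below u.\<close>

lemma sum_external_nodes_node:
  fixes f :: "nat \<Rightarrow> nat \<Rightarrow> real"
  assumes x: "is_tree x" and u: "u \<in> x"
  defines "c \<equiv> fringe_size x (u @ [False])" and "d \<equiv> fringe_size x (u @ [True])"
  shows "(\<Sum>w \<in> {w \<in> external_nodes x. prefix u w}.
        f (fringe_size (insert w x) (u @ [False])) (fringe_size (insert w x) (u @ [True]))) =
      (c + 1) * f (c + 1) d + (d + 1) * f c (d + 1)" (is ?A)
    and "(\<Sum>w \<in> external_nodes x.
        f (fringe_size (insert w x) (u @ [False])) (fringe_size (insert w x) (u @ [True]))) =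
      (c + 1) * f (c + 1) d + (d + 1) * f c (d + 1) + (real (card x) - (c + d + 1)) * f c d" (is ?B)
proof -
  let ?E = "external_nodes x"
  let ?L = "{w \<in> ?E. prefix (u @ [False]) w}" and ?R = "{w \<in> ?E. prefix (u @ [True]) w}"
  let ?f = "\<lambda>w. f (fringe_size (insert w x) (u @ [False])) (fringe_size (insert w x) (u @ [True]))"
  note fin = is_treeD(1)[OF x] finite_external_nodes[OF is_treeD(1)[OF x]]
  have notin: "w \<notin> x" if "w \<in> ?E" for w using that by (simp add: external_nodes_def)
  have "prefix u w \<longleftrightarrow> prefix (u @ [False]) w \<or> prefix (u @ [True]) w" if "w \<in> ?E" for w
    using prefix_children[of u w] u notin[OF that] by blast
  then have eq: "{w \<in> ?E. prefix u w} = ?L \<union> ?R"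
    by blast
  have disj: "?L \<inter> ?R = {}" using not_prefix_both_children[of u True] by auto
  have "sum ?f ?L = (\<Sum>w\<in>?L. f (c + 1) d)"
    using not_prefix_both_children[of u False]
    by (intro sum.cong refl) (auto simp: fringe_size_insert fin(1) notin c_def d_def)
  moreover have "sum ?f ?R = (\<Sum>w\<in>?R. f c (d + 1))"
    using not_prefix_both_children[of u True]
    by (intro sum.cong refl) (auto simp: fringe_size_insert fin(1) notin c_def d_def)
  ultimately show A: ?A
    unfolding eq using disj fin
    by (subst sum.union_disjoint)
       (auto simp: card_external_nodes_above_child[OF x u] c_def d_def add.commute)
  have "sum ?f {w \<in> ?E. \<not> prefix u w} = (\<Sum>w\<in>{w \<in> ?E. \<not> prefix u w}. f c d)"
    by (intro sum.cong refl)
       (auto simp: fringe_size_insert fin(1) notin c_def d_def dest: append_prefixD)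
  moreover have "real (card {w \<in> ?E. \<not> prefix u w}) = real (card x) - (c + d + 1)"
  proof -
    have "{w \<in> ?E. \<not> prefix u w} = ?E - {w \<in> ?E. prefix u w}" by auto
    then have "card {w \<in> ?E. \<not> prefix u w} = card ?E - card {w \<in> ?E. prefix u w}"
      using fin by (simp add: card_Diff_subset)
    moreover have "card {w \<in> ?E. prefix u w} \<le> card ?E"
      using fin by (auto intro: card_mono)
    ultimately show ?thesis
      using fringe_size_split[OF x u, of False]
      by (simp add: card_external_nodes[OF x] card_external_nodes_above[OF x u] c_def d_def)
  qed
  moreover have "sum ?f ?E = sum ?f {w \<in> ?E. prefix u w} + sum ?f {w \<in> ?E. \<not> prefix u w}"
    using fin by (subst sum.union_disjoint[symmetric]) (auto intro!: sum.cong)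
  ultimately show ?B using A by simp
qed

text \<open>\<open>mean_IPL n\<close> is the expected internal path length of the \<open>n\<close>th tree of the chain.\<close>

definition mean_IPL :: "nat \<Rightarrow> real" where
  "mean_IPL n = 2 * (real n + 1) * harm n - 4 * real n"

text \<open>The term c + d counts the nodes strictly below a node; each owes it one unit of depth.
  The rest replaces the path lengths of both subtrees and of the whole by their means.\<close>

definition split_toll :: "nat \<Rightarrow> nat \<Rightarrow> real" where
  "split_toll c d = real (c + d) + mean_IPL c + mean_IPL d - mean_IPL (Suc (c + d))"

text \<open>The value 0 outside the tree agrees with \<open>split_toll 0 0\<close>, so a node that
  enters as a leaf causes no jump.\<close>

definition toll :: "bool list set \<Rightarrow> bool list \<Rightarrow> real" where
  "toll x u = (if u \<in> x then split_toll (fringe_size x (u @ [False])) (fringe_size x (u @ [True])) else 0)"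

lemma mean_IPL_0 [simp]: "mean_IPL 0 = 0"
  by (simp add: mean_IPL_def harm_expand)

text \<open>The n + 1 external nodes have total depth IPL + 2 n, and a new node adds the depth of a
  uniformly chosen one; this is the resulting recursion for the mean.\<close>

lemma mean_IPL_Suc: "(real n + 1) * mean_IPL (Suc n) = (real n + 2) * mean_IPL n + 2 * real n"
  by (simp add: mean_IPL_def harm_Suc field_simps)

lemma split_toll_0 [simp]: "split_toll 0 0 = 0"
  by (simp add: split_toll_def mean_IPL_def harm_def)

text \<open>The urn multiplies the toll by c + d + 3 = s + 2. Its proof applies the recursion of
  \<open>mean_IPL\<close> at c, at d and at c + d + 1.\<close>

lemma split_toll_step:
  "(real c + 1) * split_toll (c + 1) d + (real d + 1) * split_toll c (d + 1) =
     (real c + real d + 3) * split_toll c d"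
proof -
  have "(real c + 1) * mean_IPL (Suc c) = (real c + 2) * mean_IPL c + 2 * real c"
    and "(real d + 1) * mean_IPL (Suc d) = (real d + 2) * mean_IPL d + 2 * real d"
    and "(real c + real d + 2) * mean_IPL (Suc (Suc (c + d))) =
      (real c + real d + 3) * mean_IPL (Suc (c + d)) + 2 * (real c + real d + 1)"
    using mean_IPL_Suc[of c] mean_IPL_Suc[of d] mean_IPL_Suc[of "Suc (c + d)"]
    by (simp_all add: algebra_simps)
  then show ?thesis
    unfolding split_toll_def by simp algebra
qed

text \<open>Collecting the harmonic numbers serves both the linear bound and the limit of the
  toll.\<close>

lemma split_toll_eq:
  "split_toll c d = real (c + d + 1) + 3
     + 2 * ((real c + 1) * harm c + (real d + 1) * harm d - (real (c + d + 1) + 1) * harm (c + d + 1))"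
  by (simp add: split_toll_def mean_IPL_def algebra_simps)

text \<open>Since (c + 1) + (d + 1) = s + 1, only differences of harmonic numbers remain. They
  confine the toll to the interval from 1 - s to s + 3, and s + 3 \<le> 4 s gives the factor
  4.\<close>

lemma abs_split_toll_le: "\<bar>split_toll c d\<bar> \<le> 4 * (real c + real d + 1)"
proof -
  let ?s = "Suc (c + d)"
  have mono: "harm m \<le> (harm ?s :: real)" if "m \<le> ?s" for m
    using that by (rule harm_mono)
  \<comment> \<open>The difference has s - m summands, each at most 1 / (m + 1).\<close>
  have lip: "(real m + 1) * (harm ?s - harm m) \<le> real ?s - real m" if "m \<le> ?s" for m
    using that
  proof (induction rule: dec_induct)
    case (step n)
    have "(real m + 1) * inverse (real (Suc n)) \<le> 1"
      using step by (simp add: field_simps)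
    then show ?case using step by (simp add: harm_Suc algebra_simps)
  qed simp
  have eq: "split_toll c d = real ?s + 3 +
      2 * ((real c + 1) * (harm c - harm ?s) + (real d + 1) * (harm d - harm ?s))"
    by (simp add: split_toll_eq algebra_simps)
  have "(real c + 1) * (harm c - harm ?s) \<le> 0" "(real d + 1) * (harm d - harm ?s) \<le> 0"
    using mono[of c] mono[of d] by (auto simp: mult_nonneg_nonpos)
  then show ?thesis
    using eq lip[of c] lip[of d] by (simp add: algebra_simps)
qed

lemma abs_toll_le: "is_tree x \<Longrightarrow> \<bar>toll x u\<bar> \<le> 4 * real (fringe_size x u)"
  using abs_split_toll_le[of "fringe_size x (u @ [False])" "fringe_size x (u @ [True])"]
    fringe_size_split[of x u False] by (simp add: toll_def)

lemma IPL_eq_sum_toll: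
  assumes x: "is_tree x"
  shows "real (IPL x) = mean_IPL (card x) + (\<Sum>u\<in>x. toll x u)"
proof -
  note fin = is_treeD(1)[OF x]
  \<comment> \<open>Count the pairs of a node v and a prefix u of v in two ways.\<close>
  have sum_size: "(\<Sum>u\<in>x. fringe_size x u) = IPL x + card x"
  proof -
    have "(\<Sum>u\<in>x. fringe_size x u) = (\<Sum>u\<in>x. \<Sum>v\<in>x. of_bool (prefix u v))"
      by (simp add: fringe_size_def fin Int_def)
    also have "\<dots> = (\<Sum>v\<in>x. card {u\<in>x. prefix u v})"
      by (subst sum.swap) (simp add: fin Int_def)
    also have "\<dots> = (\<Sum>v\<in>x. Suc (length v))"
    proof (intro sum.cong refl)
      fix v assume "v \<in> x"
      then have "{u\<in>x. prefix u v} = set (prefixes v)"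
        using is_treeD(3)[OF x] by (auto simp: set_prefixes_eq)
      then show "card {u\<in>x. prefix u v} = Suc (length v)"
        by (simp add: distinct_card)
    qed
    finally show ?thesis by (simp add: IPL_def sum_Suc)
  qed
  \<comment> \<open>Every node except the root is a child exactly once; children outside the tree
    contribute \<open>mean_IPL 0 = 0\<close>.\<close>
  have children: "(\<Sum>u\<in>x. \<Sum>b\<in>UNIV. mean_IPL (fringe_size x (u @ [b]))) =
      (\<Sum>v\<in>x. mean_IPL (fringe_size x v)) - mean_IPL (card x)"
  proof -
    have "(\<Sum>u\<in>x. \<Sum>b\<in>UNIV. mean_IPL (fringe_size x (u @ [b]))) =
        (\<Sum>v\<in>(\<lambda>(u, b). u @ [b]) ` (x \<times> UNIV). mean_IPL (fringe_size x v))"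
      by (subst sum.reindex) (auto simp: inj_on_def sum.cartesian_product case_prod_unfold)
    also have "\<dots> = (\<Sum>v\<in>x - {[]}. mean_IPL (fringe_size x v))"
    proof (rule sum.mono_neutral_right)
      show "x - {[]} \<subseteq> (\<lambda>(u, b). u @ [b]) ` (x \<times> UNIV)"
      proof
        fix w assume "w \<in> x - {[]}"
        then show "w \<in> (\<lambda>(u, b). u @ [b]) ` (x \<times> UNIV)"
          using butlast_mem_tree[OF x, of w]
          by (intro image_eqI[of _ _ "(butlast w, last w)"]) auto
      qed
    next
      show "\<forall>v\<in>(\<lambda>(u, b). u @ [b]) ` (x \<times> UNIV) - (x - {[]}). mean_IPL (fringe_size x v) = 0"
      proof
        fix v assume "v \<in> (\<lambda>(u, b). u @ [b]) ` (x \<times> UNIV) - (x - {[]})"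
        then have "v \<notin> x" by auto
        then show "mean_IPL (fringe_size x v) = 0" by (simp add: fringe_size_notin[OF x])
      qed
    qed (use fin in auto)
    also have "\<dots> = (\<Sum>v\<in>x. mean_IPL (fringe_size x v)) - mean_IPL (card x)"
      using is_treeD(2)[OF x] fin by (simp add: sum_diff1 fringe_size_root)
    finally show ?thesis .
  qed
  have "(\<Sum>u\<in>x. toll x u) = (\<Sum>u\<in>x. (real (fringe_size x u) - 1)
      + (\<Sum>b\<in>UNIV. mean_IPL (fringe_size x (u @ [b]))) - mean_IPL (fringe_size x u))"
    by (intro sum.cong refl)
       (simp add: toll_def split_toll_def fringe_size_split[OF x, of _ False] UNIV_bool)
  also have "\<dots> = real (IPL x) - mean_IPL (card x)"
    using sum_size by (simp add: sum.distrib sum_subtractf children flip: of_nat_sum)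
  finally show ?thesis by simp
qed

lemma fringe_size_insert_leaf:
  assumes x: "is_tree x" and w: "w \<in> external_nodes x"
  shows "fringe_size (insert w x) (w @ [b]) = 0"
proof -
  have "w \<notin> x" using w by (simp add: external_nodes_def)
  then have "w @ [b] \<notin> x" using is_treeD(3)[OF x, of "w @ [b]" w] by auto
  then show ?thesis
    using \<open>w \<notin> x\<close> by (simp add: fringe_size_insert[OF is_treeD(1)[OF x]] fringe_size_notin[OF x])
qed

lemma toll_insert_notin:
  assumes x: "is_tree x" and u: "u \<notin> x" and w: "w \<in> external_nodes x"
  shows "toll (insert w x) u = 0"
  using u fringe_size_insert_leaf[OF x w] by (auto simp: toll_def)

text \<open>Restricting the average to insertions below u keeps everything outside the subtree
  fixed, as the orthogonality argument requires.\<close>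

lemma sum_toll_insert_above:
  assumes x: "is_tree x" and u: "u \<in> x"
  shows "(\<Sum>w | w \<in> external_nodes x \<and> prefix u w. toll (insert w x) u) =
    (real (fringe_size x u) + 2) * toll x u"
  using sum_external_nodes_node(1)[OF x u, of split_toll]
    split_toll_step[of "fringe_size x (u @ [False])" "fringe_size x (u @ [True])"]
    fringe_size_split[OF x u, of False] u
  by (simp add: toll_def algebra_simps)

text \<open>The eigenvalue s + 2 from insertions below u and the weight \<open>card x\<close> - s of
  the other insertions add up to \<open>card x + 2\<close>.\<close>

lemma sum_toll_insert:
  assumes x: "is_tree x"
  shows "(\<Sum>w \<in> external_nodes x. toll (insert w x) u) = (real (card x) + 2) * toll x u"
proof (cases "u \<in> x")
  case True
  show ?thesis
    using sum_external_nodes_node(2)[OF x True, of split_toll]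
      split_toll_step[of "fringe_size x (u @ [False])" "fringe_size x (u @ [True])"] True
    by (simp add: toll_def algebra_simps)
next
  case False
  then show ?thesis using toll_insert_notin[OF x] by (simp add: toll_def)
qed

subsection \<open>The law of the chain\<close>

text \<open>The index is shifted: \<open>path_law n\<close> is the law of the first \<open>n + 1\<close> trees of the chain, so its
  last tree has \<open>n + 1\<close> nodes.\<close>

primrec path_law :: "nat \<Rightarrow> bool list set list pmf" where
  "path_law 0 = return_pmf [{[]}]"
| "path_law (Suc n) = bind_pmf (path_law n) (\<lambda>p. map_pmf (\<lambda>x. p @ [x]) (bst_step (last p)))"

abbreviation path_mean :: "nat \<Rightarrow> (bool list set list \<Rightarrow> real) \<Rightarrow> real" where
  "path_mean n f \<equiv> measure_pmf.expectation (path_law n) f"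

abbreviation tree_mean :: "nat \<Rightarrow> (bool list set \<Rightarrow> real) \<Rightarrow> real" where
  "tree_mean n f \<equiv> path_mean n (\<lambda>p. f (last p))"

lemma external_nodes_finite_nonempty:
  assumes "is_tree x" shows "finite (external_nodes x)" "external_nodes x \<noteq> {}"
proof -
  show "finite (external_nodes x)" by (rule finite_external_nodes[OF is_treeD(1)[OF assms]])
  show "external_nodes x \<noteq> {}" using card_external_nodes[OF assms] by auto
qed

lemma set_pmf_bst_step:
  "is_tree x \<Longrightarrow> set_pmf (bst_step x) = (\<lambda>w. insert w x) ` external_nodes x"
  by (simp add: bst_step_def external_nodes_finite_nonempty)

lemma card_insert_external:
  "is_tree x \<Longrightarrow> w \<in> external_nodes x \<Longrightarrow> card (insert w x) = Suc (card x)"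
  by (simp add: is_treeD(1) external_nodes_def)

lemma path_law_support:
  "p \<in> set_pmf (path_law n) \<Longrightarrow>
     length p = Suc n \<and> is_tree (last p) \<and> card (last p) = Suc n"
proof (induction n arbitrary: p)
  case 0
  then show ?case using is_tree_root by simp
next
  case (Suc n)
  then obtain q x where q: "q \<in> set_pmf (path_law n)" "x \<in> set_pmf (bst_step (last q))" "p = q @ [x]"
    by auto
  note IH = Suc.IH[OF q(1)]
  then obtain w where "w \<in> external_nodes (last q)" "x = insert w (last q)"
    using q(2) set_pmf_bst_step by auto
  then show ?case using IH q(3) is_tree_insert card_insert_external by simp
qed

text \<open>Finite support makes every real function of a path integrable, so the means below carry
  no side conditions.\<close>

lemma finite_path_law: "finite (set_pmf (path_law n))"
  by (induction n)
     (auto simp: set_pmf_bst_step external_nodes_finite_nonempty dest: path_law_support)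

lemma integrable_path_law: "integrable (path_law n) (f :: _ \<Rightarrow> real)"
  by (rule integrable_measure_pmf_finite[OF finite_path_law])

lemma path_mean_mono:
  assumes "\<And>p. p \<in> set_pmf (path_law n) \<Longrightarrow> f p \<le> g p"
  shows "path_mean n f \<le> path_mean n g"
  by (rule integral_mono_AE[OF integrable_path_law integrable_path_law])
     (use assms in \<open>simp add: AE_measure_pmf_iff\<close>)

lemma path_mean_cong:
  assumes "\<And>p. p \<in> set_pmf (path_law n) \<Longrightarrow> f p = g p"
  shows "path_mean n f = path_mean n g"
  by (intro antisym path_mean_mono) (auto simp: assms)

lemma path_mean_sum: "path_mean n (\<lambda>p. \<Sum>i\<in>A. f i p) = (\<Sum>i\<in>A. path_mean n (f i))"
  by (rule Bochner_Integration.integral_sum) (rule integrable_path_law)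

text \<open>This plays the role of conditioning on the past; the last tree has n + 1 nodes and hence
  n + 2 external nodes.\<close>

lemma path_mean_Suc:
  "path_mean (Suc n) f =
     path_mean n (\<lambda>p. (\<Sum>w\<in>external_nodes (last p). f (p @ [insert w (last p)])) / (real n + 2))"
proof -
  have step: "measure_pmf.expectation (map_pmf (\<lambda>x. p @ [x]) (bst_step (last p))) f =
      (\<Sum>w\<in>external_nodes (last p). f (p @ [insert w (last p)])) / (real n + 2)"
    if p: "p \<in> set_pmf (path_law n)" for p
    using path_law_support[OF p] external_nodes_finite_nonempty[of "last p"]
    by (simp add: bst_step_def integral_pmf_of_set card_external_nodes add.commute)
  have "path_mean (Suc n) f = (\<Sum>p\<in>set_pmf (path_law n). pmf (path_law n) p *\<^sub>R
      measure_pmf.expectation (map_pmf (\<lambda>x. p @ [x]) (bst_step (last p))) f)"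
    unfolding path_law.simps
    by (rule pmf_expectation_bind[OF finite_path_law])
       (auto simp: set_pmf_bst_step external_nodes_finite_nonempty dest: path_law_support)
  also have "\<dots> = path_mean n (\<lambda>p. (\<Sum>w\<in>external_nodes (last p). f (p @ [insert w (last p)])) / (real n + 2))"
    by (subst integral_measure_pmf[OF finite_path_law[of n], of "path_law n"])
       (auto intro!: sum.cong simp only: step)
  finally show ?thesis .
qed

lemma tree_mean_cong:
  assumes "\<And>x. is_tree x \<Longrightarrow> card x = Suc n \<Longrightarrow> f x = g x"
  shows "tree_mean n f = tree_mean n g"
  using assms path_law_support by (intro path_mean_cong) blast

lemma tree_mean_mono:
  assumes "\<And>x. is_tree x \<Longrightarrow> card x = Suc n \<Longrightarrow> f x \<le> g x"
  shows "tree_mean n f \<le> tree_mean n g"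
  using assms path_law_support by (intro path_mean_mono) blast

lemma tree_mean_Suc_eq:
  assumes "\<And>x. is_tree x \<Longrightarrow> card x = Suc n \<Longrightarrow> (\<Sum>w\<in>external_nodes x. f (insert w x)) = g x"
  shows "tree_mean (Suc n) f = tree_mean n g / (real n + 2)"
proof -
  have "tree_mean (Suc n) f = tree_mean n (\<lambda>x. g x / (real n + 2))"
    unfolding path_mean_Suc using assms path_law_support
    by (intro path_mean_cong) (simp only: last_snoc)
  then show ?thesis by simp
qed

subsection \<open>Moments of the tolls\<close>

lemma fringe_size_singleton: "u \<noteq> [] \<Longrightarrow> fringe_size {[]} u = 0"
  by (rule fringe_size_notin[OF is_tree_root]) simp

lemma toll_singleton: "toll {[]} u = 0"
  by (simp add: toll_def fringe_size_singleton)

text \<open>Given the size of the subtree at \<open>v\<close> and everything outside it, the toll at \<open>v\<close> has mean 0.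
  Quantifying over all \<open>F\<close> makes the statement inductive, since averaging over one step only changes \<open>F\<close>.\<close>

lemma tree_mean_toll_outside:
  "tree_mean n (\<lambda>x. F {w\<in>x. \<not> prefix v w} (fringe_size x v) * toll x v) = 0"
proof (induction n arbitrary: F)
  case 0
  then show ?case by (simp add: toll_singleton)
next
  case (Suc n)
  \<comment> \<open>An insertion below \<open>v\<close> raises t and yields the eigenvalue t + 2; an
    insertion elsewhere changes the outer part y. The node \<open>v\<close> is excluded because
    removing its subtree turns it into an external node of y.\<close>
  define G where "G y t = (real t + 2) * F y (Suc t)
    + (\<Sum>w\<in>external_nodes y - {v}. F (insert w y) t)" for y t
  have "tree_mean (Suc n) (\<lambda>x. F {w\<in>x. \<not> prefix v w} (fringe_size x v) * toll x v) =
      tree_mean n (\<lambda>x. G {w\<in>x. \<not> prefix v w} (fringe_size x v) * toll x v) / (real n + 2)"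
  proof (rule tree_mean_Suc_eq)
    fix x assume x: "is_tree x"
    let ?o = "{w\<in>x. \<not> prefix v w}" and ?t = "fringe_size x v" and ?E = "external_nodes x"
    let ?f = "\<lambda>w. F {z\<in>insert w x. \<not> prefix v z} (fringe_size (insert w x) v) * toll (insert w x) v"
    note finx = is_treeD(1)[OF x] and finE = finite_external_nodes[OF is_treeD(1)[OF x]]
    show "sum ?f ?E = G ?o ?t * toll x v"
    proof (cases "v \<in> x")
      case False
      then show ?thesis using toll_insert_notin[OF x] by (simp add: toll_def)
    next
      case True
      have notin: "w \<notin> x" if "w \<in> ?E" for w using that by (simp add: external_nodes_def)
      have "sum ?f {w\<in>?E. prefix v w} = (\<Sum>w\<in>{w\<in>?E. prefix v w}. F ?o (Suc ?t) * toll (insert w x) v)"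
      proof (intro sum.cong refl)
        fix w assume w: "w \<in> {w\<in>?E. prefix v w}"
        then have "{z\<in>insert w x. \<not> prefix v z} = ?o" by auto
        then show "?f w = F ?o (Suc ?t) * toll (insert w x) v"
          using w notin by (simp add: fringe_size_insert[OF finx])
      qed
      then have above: "sum ?f {w\<in>?E. prefix v w} = (real ?t + 2) * F ?o (Suc ?t) * toll x v"
        using sum_toll_insert_above[OF x True] by (simp flip: sum_distrib_left)
      have eq: "{w\<in>?E. \<not> prefix v w} = external_nodes ?o - {v}"
      proof (intro set_eqI iffI)
        fix w assume "w \<in> {w\<in>?E. \<not> prefix v w}"
        then show "w \<in> external_nodes ?o - {v}"
          by (auto simp: external_nodes_def prefix_butlast_iff)
      next
        fix w assume w: "w \<in> external_nodes ?o - {v}"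
        then have "\<not> prefix v w"
          by (auto simp: external_nodes_def prefix_butlast_iff)
        then show "w \<in> {w\<in>?E. \<not> prefix v w}"
          using w by (auto simp: external_nodes_def)
      qed
      have "sum ?f {w\<in>?E. \<not> prefix v w} =
          (\<Sum>w\<in>{w\<in>?E. \<not> prefix v w}. F (insert w ?o) ?t * toll x v)"
      proof (intro sum.cong refl)
        fix w assume w: "w \<in> {w\<in>?E. \<not> prefix v w}"
        then have "{z\<in>insert w x. \<not> prefix v z} = insert w ?o" by auto
        moreover have "fringe_size (insert w x) (v @ z) = fringe_size x (v @ z)" for z
          using w notin by (auto simp: fringe_size_insert[OF finx] dest: append_prefixD)
        from this[of "[]"] this[of "[False]"] this[of "[True]"]
        have "fringe_size (insert w x) v = ?t" "toll (insert w x) v = toll x v"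
          using w True by (auto simp: toll_def)
        ultimately show "?f w = F (insert w ?o) ?t * toll x v" by simp
      qed
      then have "sum ?f {w\<in>?E. \<not> prefix v w} =
          (\<Sum>w\<in>external_nodes ?o - {v}. F (insert w ?o) ?t) * toll x v"
        by (simp only: eq sum_distrib_right)
      moreover have "sum ?f ?E = sum ?f {w\<in>?E. prefix v w} + sum ?f {w\<in>?E. \<not> prefix v w}"
        using finE by (subst sum.union_disjoint[symmetric]) (auto intro!: sum.cong)
      ultimately show ?thesis using above by (simp add: G_def algebra_simps)
    qed
  qed
  then show ?case using Suc.IH[of G] by simp
qed

text \<open>The subtree at a node not strictly below v either contains the subtree at v entirely or
  avoids it.\<close>

lemma fringe_size_outside:
  assumes x: "is_tree x" and z: "prefix v z \<Longrightarrow> z = v"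
  shows "fringe_size x z =
    card {w \<in> {w\<in>x. \<not> prefix v w}. prefix z w} + (if prefix z v then fringe_size x v else 0)"
proof -
  have "{w\<in>x. prefix z w} = {w \<in> {w\<in>x. \<not> prefix v w}. prefix z w} \<union>
      (if prefix z v then {w\<in>x. prefix v w} else {})"
    using z by (auto dest: prefix_same_cases intro: prefix_order.trans)
  moreover have "card \<dots> = card {w \<in> {w\<in>x. \<not> prefix v w}. prefix z w} +
      card (if prefix z v then {w\<in>x. prefix v w} else {})"
    using is_treeD(1)[OF x] by (intro card_Un_disjoint) auto
  ultimately show ?thesis by (simp add: fringe_size_def)
qed

text \<open>The toll at u is then a function of the part outside v and of the size at v, and
  \<open>tree_mean_toll_outside\<close> allows any such factor.\<close>

lemma tree_mean_toll_mult_not_prefix: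
  assumes "\<not> prefix v u"
  shows "tree_mean n (\<lambda>x. toll x u * toll x v) = 0"
proof -
  define s where "s y t z = card {w\<in>y. prefix z w} + (if prefix z v then t else 0)" for y :: "bool list set" and t z
  define F where "F y t = (if u \<in> y then split_toll (s y t (u @ [False])) (s y t (u @ [True])) else 0)" for y t
  have "tree_mean n (\<lambda>x. toll x u * toll x v) =
      tree_mean n (\<lambda>x. F {w\<in>x. \<not> prefix v w} (fringe_size x v) * toll x v)"
  proof (rule tree_mean_cong)
    fix x assume x: "is_tree x"
    \<comment> \<open>A child of \<open>u\<close> may be \<open>v\<close> itself but cannot lie
      strictly below it.\<close>
    have "fringe_size x (u @ [b]) = s {w\<in>x. \<not> prefix v w} (fringe_size x v) (u @ [b])" for b
      unfolding s_def using assms by (intro fringe_size_outside[OF x]) auto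
    then show "toll x u * toll x v = F {w\<in>x. \<not> prefix v w} (fringe_size x v) * toll x v"
      using assms by (simp add: F_def toll_def)
  qed
  then show ?thesis using tree_mean_toll_outside by simp
qed

lemma tree_mean_toll_mult:
  assumes "u \<noteq> v"
  shows "tree_mean n (\<lambda>x. toll x u * toll x v) = 0"
proof (cases "prefix v u")
  case True
  then have "\<not> prefix u v" using assms by (auto dest: prefix_order.antisym)
  then show ?thesis
    using tree_mean_toll_mult_not_prefix[of u v n] by (simp add: mult.commute)
qed (rule tree_mean_toll_mult_not_prefix)

lemma tree_mean_sum_toll_squared:
  assumes "finite A"
  shows "tree_mean n (\<lambda>x. (\<Sum>u\<in>A. toll x u)\<^sup>2) = (\<Sum>u\<in>A. tree_mean n (\<lambda>x. (toll x u)\<^sup>2))"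
proof -
  have "tree_mean n (\<lambda>x. (\<Sum>u\<in>A. toll x u)\<^sup>2) = (\<Sum>u\<in>A. \<Sum>v\<in>A. tree_mean n (\<lambda>x. toll x u * toll x v))"
    by (simp add: power2_eq_square sum_product path_mean_sum)
  also have "\<dots> = (\<Sum>u\<in>A. \<Sum>v\<in>A. if v = u then tree_mean n (\<lambda>x. (toll x u)\<^sup>2) else 0)"
    using tree_mean_toll_mult by (intro sum.cong refl) (auto simp: power2_eq_square)
  also have "\<dots> = (\<Sum>u\<in>A. tree_mean n (\<lambda>x. (toll x u)\<^sup>2))"
    using assms by simp
  finally show ?thesis .
qed

text \<open>The weight \<open>(s + 1) (s + 2)\<close> for a subtree of size \<open>s\<close> is used since it is an eigenfunction of the
  one-step average and since its mean over a uniform \<open>s < t\<close> is exactly a third of \<open>(t + 1) (t + 2)\<close>.\<close>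

definition node_weight :: "bool list set \<Rightarrow> bool list \<Rightarrow> real" where
  "node_weight x u = (if u \<in> x then (real (fringe_size x u) + 1) * (real (fringe_size x u) + 2) else 0)"

text \<open>The weight of a child minus a third of the weight of its parent is an eigenfunction that
  vanishes at the initial tree, so its mean is always 0. Only an inequality results, because
  \<open>node_weight\<close> is 0 at a missing child.\<close>

lemma tree_mean_node_weight_child:
  "tree_mean n (\<lambda>x. node_weight x (u @ [b])) \<le> tree_mean n (\<lambda>x. node_weight x u) / 3"
proof -
  \<comment> \<open>An empty child counts with weight 2 here, which is what makes
    \<open>f 0 0\<close> vanish.\<close>
  define f where "f c d = (let e = (if b then d else c) in
    (real e + 1) * (real e + 2) - (real c + real d + 2) * (real c + real d + 3) / 3)" for c d :: nat
  define h where "h x = (if u \<in> x then f (fringe_size x (u @ [False])) (fringe_size x (u @ [True])) else 0)" for x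
  have f0: "f 0 0 = 0" by (simp add: f_def)
  have "tree_mean n h = 0"
  proof (induction n)
    case 0
    then show ?case by (simp add: h_def fringe_size_singleton f0)
  next
    case (Suc n)
    have "tree_mean (Suc n) h = tree_mean n (\<lambda>x. (real (card x) + 3) * h x) / (real n + 2)"
    proof (rule tree_mean_Suc_eq)
      fix x assume x: "is_tree x"
      show "(\<Sum>w\<in>external_nodes x. h (insert w x)) = (real (card x) + 3) * h x"
      proof (cases "u \<in> x")
        case True
        \<comment> \<open>The factor is s + 3; with the resting weight \<open>card x\<close> - s the
          eigenvalue becomes \<open>card x + 3\<close>.\<close>
        have step: "(real c + 1) * f (c + 1) d + (real d + 1) * f c (d + 1) = (real c + real d + 4) * f c d" for c d
          by (cases b) (simp_all add: f_def Let_def field_simps)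
        have "(\<Sum>w\<in>external_nodes x. h (insert w x)) =
            (\<Sum>w\<in>external_nodes x. f (fringe_size (insert w x) (u @ [False])) (fringe_size (insert w x) (u @ [True])))"
          using True by (simp add: h_def)
        also have "\<dots> = (real (card x) + 3) * h x"
          unfolding sum_external_nodes_node(2)[OF x True] step
          using True by (simp add: h_def algebra_simps)
        finally show ?thesis .
      next
        case False
        have "h (insert w x) = 0" if w: "w \<in> external_nodes x" for w
          using False f0 fringe_size_insert_leaf[OF x w] by (auto simp: h_def)
        then show ?thesis using False by (simp add: h_def)
      qed
    qed
    also have "tree_mean n (\<lambda>x. (real (card x) + 3) * h x) = tree_mean n (\<lambda>x. (real n + 4) * h x)"
      by (rule tree_mean_cong) simp
    finally show ?case using Suc by simp
  qed
  moreover have "tree_mean n (\<lambda>x. node_weight x (u @ [b])) \<le> tree_mean n (\<lambda>x. h x + node_weight x u / 3)"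
  proof (intro path_mean_mono)
    fix p assume "p \<in> set_pmf (path_law n)"
    then have x: "is_tree (last p)" using path_law_support by blast
    let ?x = "last p"
    show "node_weight ?x (u @ [b]) \<le> h ?x + node_weight ?x u / 3"
    proof (cases "u \<in> ?x")
      case True
      have "real (fringe_size ?x u) =
          real (fringe_size ?x (u @ [False])) + real (fringe_size ?x (u @ [True])) + 1"
        using fringe_size_split[OF x True, of False] by simp
      then have "h ?x = (real (fringe_size ?x (u @ [b])) + 1) * (real (fringe_size ?x (u @ [b])) + 2)
          - (real (fringe_size ?x u) + 1) * (real (fringe_size ?x u) + 2) / 3"
        using True by (cases b) (simp_all add: h_def f_def Let_def add_ac)
      then show ?thesis
        using True by (simp add: node_weight_def)
    next
      case False
      then have "u @ [b] \<notin> ?x" using is_treeD(3)[OF x, of "u @ [b]" u] by auto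
      then show ?thesis using False by (simp add: node_weight_def h_def)
    qed
  qed
  ultimately show ?thesis
    by (simp add: Bochner_Integration.integral_add[OF integrable_path_law integrable_path_law])
qed

lemma tree_mean_node_weight:
  "tree_mean n (\<lambda>x. node_weight x u) \<le> (real n + 2) * (real n + 3) * (1 / 3) ^ length u"
proof (induction u rule: rev_induct)
  case Nil
  have "tree_mean n (\<lambda>x. node_weight x []) = tree_mean n (\<lambda>x. (real n + 2) * (real n + 3))"
    by (rule tree_mean_cong) (simp add: node_weight_def is_treeD(2) fringe_size_root algebra_simps)
  then show ?case by simp
next
  case (snoc b u)
  then show ?case using tree_mean_node_weight_child[of n u b] by simp
qed

text \<open>The factor 16 is the square of the 4 in \<open>abs_toll_le\<close>.\<close>

lemma tree_mean_toll_squared: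
  "tree_mean n (\<lambda>x. (toll x u)\<^sup>2) \<le> 16 * (real n + 2) * (real n + 3) * (1 / 3) ^ length u"
proof -
  have "tree_mean n (\<lambda>x. (toll x u)\<^sup>2) \<le> tree_mean n (\<lambda>x. 16 * node_weight x u)"
  proof (rule tree_mean_mono)
    fix x assume x: "is_tree x"
    let ?s = "real (fringe_size x u)"
    show "(toll x u)\<^sup>2 \<le> 16 * node_weight x u"
    proof (cases "u \<in> x")
      case True
      have "(toll x u)\<^sup>2 \<le> (4 * ?s)\<^sup>2"
        using abs_toll_le[OF x, of u] by (simp only: abs_le_square_iff[symmetric])
      also have "\<dots> \<le> 16 * node_weight x u"
        using True by (simp add: node_weight_def power2_eq_square algebra_simps)
      finally show ?thesis .
    qed (simp add: toll_def node_weight_def)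
  qed
  then show ?thesis using tree_mean_node_weight[of n u] by (simp add: algebra_simps)
qed

lemma finite_nodes_length: "finite {u :: bool list. length u = k}" "card {u :: bool list. length u = k} = 2 ^ k"
  using finite_lists_length_eq[of "UNIV :: bool set" k] card_lists_length_eq[of "UNIV :: bool set" k]
  by simp_all

lemma finite_nodes_length_le: "finite {u :: bool list. length u \<le> k}"
  using finite_lists_length_le[of "UNIV :: bool set" k] by simp

text \<open>Depth j contributes (2/3)^j, and these powers sum to 2 (2/3)^k over all j > k.\<close>

lemma sum_geometric_nodes:
  fixes A :: "bool list set"
  assumes "finite A" "\<And>u. u \<in> A \<Longrightarrow> k < length u"
  shows "(\<Sum>u\<in>A. (1 / 3 :: real) ^ length u) \<le> 2 * (2 / 3) ^ k"
proof -
  define m where "m = Max (insert k (length ` A))"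
  have m: "length u \<le> m" if "u \<in> A" for u using that assms(1) by (auto simp: m_def)
  have "k \<le> m" using assms(1) by (simp add: m_def)
  have "A \<subseteq> (\<Union>j\<in>{k<..m}. {u. length u = j})"
    using m assms(2) by auto
  then have "(\<Sum>u\<in>A. (1 / 3 :: real) ^ length u) \<le>
      (\<Sum>u\<in>(\<Union>j\<in>{k<..m}. {u :: bool list. length u = j}). (1 / 3) ^ length u)"
    by (intro sum_mono2) (auto simp: finite_nodes_length)
  also have "\<dots> = (\<Sum>j\<in>{k<..m}. \<Sum>u\<in>{u :: bool list. length u = j}. (1 / 3) ^ length u)"
    by (rule sum.UNION_disjoint) (auto simp: finite_nodes_length)
  also have "\<dots> = (\<Sum>j\<in>{k<..m}. (2 / 3) ^ j)"
    by (intro sum.cong refl) (simp add: finite_nodes_length power_divide)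
  also have "\<dots> = 2 * (2 / 3) ^ k - 2 * (2 / 3) ^ m"
    using \<open>k \<le> m\<close>
  proof (induction rule: dec_induct)
    case (step j)
    then have "{k<..Suc j} = insert (Suc j) {k<..j}" by auto
    then show ?case using step by simp
  qed simp
  finally show ?thesis using zero_le_power[of "2 / 3 :: real" m] by linarith
qed

lemma tree_mean_toll_tail:
  assumes "finite A" "\<And>u. u \<in> A \<Longrightarrow> k < length u"
  shows "tree_mean n (\<lambda>x. (\<Sum>u\<in>A. toll x u)\<^sup>2) \<le> 32 * (real n + 2) * (real n + 3) * (2 / 3) ^ k"
proof -
  have "tree_mean n (\<lambda>x. (\<Sum>u\<in>A. toll x u)\<^sup>2) \<le>
      (\<Sum>u\<in>A. 16 * (real n + 2) * (real n + 3) * (1 / 3) ^ length u)"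
    unfolding tree_mean_sum_toll_squared[OF assms(1)] by (intro sum_mono tree_mean_toll_squared)
  also have "\<dots> = 16 * (real n + 2) * (real n + 3) * (\<Sum>u\<in>A. (1 / 3) ^ length u)"
    by (simp add: sum_distrib_left)
  also have "\<dots> \<le> 16 * (real n + 2) * (real n + 3) * (2 * (2 / 3) ^ k)"
    by (intro mult_left_mono sum_geometric_nodes assms) auto
  finally show ?thesis by (simp add: algebra_simps)
qed

section \<open>The contribution of the deep nodes and its maximal inequality\<close>

definition toll_tail :: "nat \<Rightarrow> bool list set \<Rightarrow> real" where
  "toll_tail k x = (\<Sum>u | u \<in> x \<and> k < length u. toll x u)"

lemma length_less_card:
  assumes x: "is_tree x" and "u \<in> x"
  shows "length u < card x"
proof -
  have "set (prefixes u) \<subseteq> x"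
    using is_treeD(3)[OF x \<open>u \<in> x\<close>] by (auto simp: set_prefixes_eq)
  then have "card (set (prefixes u)) \<le> card x"
    by (rule card_mono[OF is_treeD(1)[OF x]])
  then show ?thesis by (simp add: distinct_card)
qed

text \<open>An index set that does not depend on the tree allows the sum to be interchanged with
  means and with sums over external nodes.\<close>

lemma toll_tail_eq:
  assumes x: "is_tree x" and "card x \<le> Suc m"
  shows "toll_tail k x = (\<Sum>u | k < length u \<and> length u \<le> m. toll x u)"
  unfolding toll_tail_def
proof (rule sum.mono_neutral_left)
  show "finite {u :: bool list. k < length u \<and> length u \<le> m}"
    by (rule finite_subset[OF _ finite_nodes_length_le[of m]]) auto
  show "{u \<in> x. k < length u} \<subseteq> {u. k < length u \<and> length u \<le> m}"
    using length_less_card[OF x] assms(2) by fastforce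
qed (auto simp: toll_def)

lemma sum_toll_tail_insert:
  assumes x: "is_tree x"
  shows "(\<Sum>w\<in>external_nodes x. toll_tail k (insert w x)) = (real (card x) + 2) * toll_tail k x"
proof -
  have "(\<Sum>w\<in>external_nodes x. toll_tail k (insert w x)) =
      (\<Sum>w\<in>external_nodes x. \<Sum>u | k < length u \<and> length u \<le> card x. toll (insert w x) u)"
    by (intro sum.cong refl toll_tail_eq) (auto simp: is_tree_insert[OF x] card_insert_external[OF x])
  then show ?thesis
    by (subst (asm) sum.swap)
       (simp add: sum_toll_insert[OF x] toll_tail_eq[OF x, of "card x"] sum_distrib_left)
qed

lemma tree_mean_toll_tail_squared:
  "tree_mean n (\<lambda>x. (toll_tail k x)\<^sup>2) \<le> 32 * (real n + 2) * (real n + 3) * (2 / 3) ^ k"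
proof -
  have "tree_mean n (\<lambda>x. (toll_tail k x)\<^sup>2) =
      tree_mean n (\<lambda>x. (\<Sum>u | k < length u \<and> length u \<le> n. toll x u)\<^sup>2)"
    by (rule tree_mean_cong) (simp add: toll_tail_eq[where m = n])
  also have "\<dots> \<le> 32 * (real n + 2) * (real n + 3) * (2 / 3) ^ k"
    by (rule tree_mean_toll_tail)
       (auto intro: finite_subset[OF _ finite_nodes_length_le[of n]])
  finally show ?thesis .
qed

text \<open>Doob's maximal inequality for the martingale \<open>toll_tail k x / (card x + 1)\<close>.\<close>

lemma path_mean_toll_tail_maximal:
  assumes "0 \<le> e"
  shows "e\<^sup>2 * path_mean n (\<lambda>p. of_bool (\<exists>x\<in>set p. e * (real (card x) + 1) \<le> \<bar>toll_tail k x\<bar>))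
    \<le> 64 * (2 / 3) ^ k"
proof -
  define b where "b x \<longleftrightarrow> e * (real (card x) + 1) \<le> \<bar>toll_tail k x\<bar>" for x
  \<comment> \<open>The martingale squared minus the squared level, switched on once the level has
    been reached. Its mean never decreases, and a nonnegative mean is the claimed inequality; this
    replaces a stopping time.\<close>
  define D where "D n p = of_bool (\<exists>x\<in>set p. b x) * ((toll_tail k (last p) / (real n + 2))\<^sup>2 - e\<^sup>2)" for n p
  have b_sq: "e\<^sup>2 \<le> (toll_tail k x / (real (card x) + 1))\<^sup>2" if "b x" for x
  proof -
    have "e \<le> \<bar>toll_tail k x / (real (card x) + 1)\<bar>"
      using that by (simp add: b_def pos_le_divide_eq)
    then show ?thesis using assms by (metis abs_le_square_iff abs_of_nonneg)
  qed
  have "0 \<le> path_mean n (D n)"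
  proof (induction n)
    case 0
    \<comment> \<open>The tail of the initial tree is 0, so the level is reached there only if it is
      0.\<close>
    have "b {[]} \<Longrightarrow> e = 0" using assms by (simp add: b_def toll_tail_def toll_singleton)
    then show ?case by (auto simp: D_def toll_tail_def toll_singleton)
  next
    case (Suc n)
    have "path_mean n (D n) \<le> path_mean (Suc n) (D (Suc n))"
      unfolding path_mean_Suc
    proof (rule path_mean_mono)
      fix p assume p: "p \<in> set_pmf (path_law n)"
      define x where "x = last p"
      have x: "is_tree x" "card x = Suc n" using path_law_support[OF p] by (auto simp: x_def)
      let ?E = "external_nodes x"
      let ?T = "\<lambda>w. toll_tail k (insert w x) / (real n + 3)"
      have cardE: "real (card ?E) = real n + 2" using card_external_nodes[OF x(1)] x(2) by simp
      have D_Suc: "D (Suc n) (p @ [insert w x]) =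
          of_bool ((\<exists>y\<in>set p. b y) \<or> b (insert w x)) * ((?T w)\<^sup>2 - e\<^sup>2)" for w
        by (simp add: D_def add.commute)
      show "D n p \<le> (\<Sum>w\<in>external_nodes (last p). D (Suc n) (p @ [insert w (last p)])) / (real n + 2)"
        unfolding x_def[symmetric]
      proof (cases "\<exists>y\<in>set p. b y")
        case True
        \<comment> \<open>After the level has been reached, the martingale property and
          Cauchy-Schwarz show that the mean square does not drop.\<close>
        have "sum ?T ?E = toll_tail k x"
          using sum_toll_tail_insert[OF x(1), of k] x(2) by (simp add: add.commute flip: sum_divide_distrib)
        then have "(toll_tail k x)\<^sup>2 \<le> (\<Sum>w\<in>?E. (?T w)\<^sup>2) * (real n + 2)"
          using sum_squared_le_sum_of_squares[of ?T ?E] cardE by simp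
        then have "(toll_tail k x)\<^sup>2 / (real n + 2) \<le> (\<Sum>w\<in>?E. (?T w)\<^sup>2)"
          by (simp only: pos_divide_le_eq)
        then have "(toll_tail k x)\<^sup>2 / (real n + 2) / (real n + 2) \<le> (\<Sum>w\<in>?E. (?T w)\<^sup>2) / (real n + 2)"
          by (rule divide_right_mono) simp
        then have "(toll_tail k x / (real n + 2))\<^sup>2 \<le> (\<Sum>w\<in>?E. (?T w)\<^sup>2) / (real n + 2)"
          by (simp only: power_divide power2_eq_square[of "real n + 2"] divide_divide_eq_left)
        moreover have "D n p = (toll_tail k x / (real n + 2))\<^sup>2 - e\<^sup>2"
          using True by (simp add: D_def x_def)
        moreover have "(\<Sum>w\<in>?E. D (Suc n) (p @ [insert w x])) = (\<Sum>w\<in>?E. (?T w)\<^sup>2) - (real n + 2) * e\<^sup>2"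
          using True cardE by (simp add: D_Suc sum_subtractf)
        ultimately show "D n p \<le> (\<Sum>w\<in>?E. D (Suc n) (p @ [insert w x])) / (real n + 2)"
          by (simp add: diff_divide_distrib)
      next
        case False
        \<comment> \<open>Before that \<open>D\<close> is 0, and if the new tree is the first to
          reach the level, its square exceeds \<open>e\<^sup>2\<close> or equals it.\<close>
        have "0 \<le> D (Suc n) (p @ [insert w x])" if w: "w \<in> ?E" for w
          using b_sq[of "insert w x"] card_insert_external[OF x(1) w] x(2) False
          by (auto simp: D_Suc add.commute)
        then show "D n p \<le> (\<Sum>w\<in>?E. D (Suc n) (p @ [insert w x])) / (real n + 2)"
          using False by (auto simp: D_def intro!: sum_nonneg divide_nonneg_nonneg)
      qed
    qed
    then show ?case using Suc by linarith
  qed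
  also have "path_mean n (D n) \<le> path_mean n (\<lambda>p. (toll_tail k (last p) / (real n + 2))\<^sup>2
      - e\<^sup>2 * of_bool (\<exists>x\<in>set p. b x))"
    by (rule path_mean_mono) (simp add: D_def)
  also have "\<dots> = tree_mean n (\<lambda>x. (toll_tail k x)\<^sup>2) / (real n + 2)\<^sup>2
      - e\<^sup>2 * path_mean n (\<lambda>p. of_bool (\<exists>x\<in>set p. b x))"
    by (simp add: Bochner_Integration.integral_diff[OF integrable_path_law integrable_path_law] power_divide)
  also have "tree_mean n (\<lambda>x. (toll_tail k x)\<^sup>2) \<le> 32 * (real n + 2) * (real n + 3) * (2 / 3) ^ k"
    by (rule tree_mean_toll_tail_squared)
  also have "\<dots> \<le> 64 * (2 / 3) ^ k * (real n + 2)\<^sup>2"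
  proof -
    have "32 * (real n + 2) * (real n + 3) \<le> 64 * (real n + 2)\<^sup>2"
      by (simp add: power2_eq_square algebra_simps)
    then show ?thesis by (simp add: mult_right_mono mult.commute mult.left_commute)
  qed
  finally show ?thesis unfolding b_def by (simp add: divide_right_mono)
qed

subsection \<open>Convergence by approximation\<close>

text \<open>Interchange of limits under approximation uniform in n. The tolerances 1 / (m + 1) are
  countably many, so an almost sure version needs a single null set.\<close>

lemma uniform_approximation_limit:
  fixes z :: "nat \<Rightarrow> real" and p :: "nat \<Rightarrow> nat \<Rightarrow> real" and y :: "nat \<Rightarrow> real"
  assumes p: "\<And>k. p k \<longlonglongrightarrow> y k"
    and approx: "\<And>m. \<forall>\<^sub>F k in sequentially. \<forall>n. \<bar>z n - p k n\<bar> < 1 / real (Suc m)"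
  shows "y \<longlonglongrightarrow> lim y" and "z \<longlonglongrightarrow> lim y"
proof -
  have "Cauchy z"
  proof (rule metric_CauchyI)
    fix e :: real assume "0 < e"
    then obtain m where m: "1 / real (Suc m) < e / 3" using nat_approx_posE[of "e / 3"] by auto
    obtain k where k: "\<And>n. \<bar>z n - p k n\<bar> < 1 / real (Suc m)"
      using approx[of m] by (auto simp: eventually_sequentially)
    have "Cauchy (p k)" using p[of k] by (rule LIMSEQ_imp_Cauchy)
    then obtain N where N: "\<And>i j. N \<le> i \<Longrightarrow> N \<le> j \<Longrightarrow> \<bar>p k i - p k j\<bar> < e / 3"
      using \<open>0 < e\<close> metric_CauchyD[of "p k" "e / 3"] by (auto simp: dist_real_def)
    have "dist (z i) (z j) < e" if "N \<le> i" "N \<le> j" for i j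
      using N[OF that] k[of i] k[of j] m unfolding dist_real_def by linarith
    then show "\<exists>N. \<forall>i\<ge>N. \<forall>j\<ge>N. dist (z i) (z j) < e" by blast
  qed
  then obtain L where L: "z \<longlonglongrightarrow> L" using real_Cauchy_convergent convergent_def by blast
  have "y \<longlonglongrightarrow> L"
  proof (rule metric_LIMSEQ_I)
    fix e :: real assume "0 < e"
    then obtain m where m: "1 / real (Suc m) < e" using nat_approx_posE[of e] by auto
    have "\<bar>L - y k\<bar> \<le> 1 / real (Suc m)" if k: "\<forall>n. \<bar>z n - p k n\<bar> < 1 / real (Suc m)" for k
      using k by (intro LIMSEQ_le_const2[of "\<lambda>n. \<bar>z n - p k n\<bar>"] tendsto_intros L p)
        (auto intro: less_imp_le)
    then have "\<forall>\<^sub>F k in sequentially. dist (y k) L < e"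
      using approx[of m] m by (auto simp: dist_real_def abs_minus_commute elim!: eventually_mono intro: le_less_trans)
    then show "\<exists>N. \<forall>k\<ge>N. dist (y k) L < e" by (simp add: eventually_sequentially)
  qed
  then have "lim y = L" by (rule limI)
  then show "y \<longlonglongrightarrow> lim y" "z \<longlonglongrightarrow> lim y" using L \<open>y \<longlonglongrightarrow> L\<close> by auto
qed

text \<open>It carries a second moment bound that is uniform in n over to the almost sure
  limit.\<close>

lemma L2_Fatou:
  fixes f :: "nat \<Rightarrow> 'a \<Rightarrow> real"
  assumes [measurable]: "\<And>n. f n \<in> borel_measurable M" "g \<in> borel_measurable M"
    and lim: "AE x in M. (\<lambda>n. f n x) \<longlonglongrightarrow> g x"
    and int: "\<And>n. integrable M (\<lambda>x. (f n x)\<^sup>2)"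
    and B: "\<And>n. (\<integral>x. (f n x)\<^sup>2 \<partial>M) \<le> B"
  shows "integrable M (\<lambda>x. (g x)\<^sup>2)" and "(\<integral>x. (g x)\<^sup>2 \<partial>M) \<le> B"
proof -
  have "(\<integral>x. (f 0 x)\<^sup>2 \<partial>M) \<ge> 0" by simp
  then have "0 \<le> B" using B[of 0] by linarith
  have "(\<integral>\<^sup>+x. ennreal ((g x)\<^sup>2) \<partial>M) = (\<integral>\<^sup>+x. liminf (\<lambda>n. ennreal ((f n x)\<^sup>2)) \<partial>M)"
    using lim
    by (intro nn_integral_cong_AE) (auto elim!: eventually_mono intro!: lim_imp_Liminf[symmetric] tendsto_intros tendsto_ennrealI)
  also have "\<dots> \<le> liminf (\<lambda>n. \<integral>\<^sup>+x. ennreal ((f n x)\<^sup>2) \<partial>M)"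
    by (rule nn_integral_liminf) simp
  also have "\<dots> \<le> ennreal B"
    by (rule Liminf_le)
       (auto simp: nn_integral_eq_integral[OF int] intro!: ennreal_leI B always_eventually)
  finally have *: "(\<integral>\<^sup>+x. ennreal ((g x)\<^sup>2) \<partial>M) \<le> ennreal B" .
  then show "integrable M (\<lambda>x. (g x)\<^sup>2)"
    by (intro integrableI_bounded) (auto intro: le_less_trans)
  then show "(\<integral>x. (g x)\<^sup>2 \<partial>M) \<le> B"
    using * \<open>0 \<le> B\<close> by (simp add: nn_integral_eq_integral)
qed

lemma square_add_le: "(a + b)\<^sup>2 \<le> 2 * a\<^sup>2 + 2 * b\<^sup>2" for a b :: real
  using sum_squares_bound[of a b] by (simp add: power2_sum)

lemma square_integrable_add:
  assumes "square_integrable M f" "square_integrable M g"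
  shows "square_integrable M (\<lambda>x. f x + g x)"
proof -
  have [measurable]: "f \<in> borel_measurable M" "g \<in> borel_measurable M"
    and int: "integrable M (\<lambda>x. (f x)\<^sup>2)" "integrable M (\<lambda>x. (g x)\<^sup>2)"
    using assms by (auto simp: square_integrable_def)
  have "integrable M (\<lambda>x. (f x + g x)\<^sup>2)"
  proof (rule Bochner_Integration.integrable_bound)
    show "integrable M (\<lambda>x. 2 * (f x)\<^sup>2 + 2 * (g x)\<^sup>2)" using int by simp
    show "AE x in M. norm ((f x + g x)\<^sup>2) \<le> norm (2 * (f x)\<^sup>2 + 2 * (g x)\<^sup>2)"
      using square_add_le by (auto intro!: AE_I2)
  qed simp
  then show ?thesis by (simp add: square_integrable_def)
qed

lemma square_integrable_integral_add_le:
  assumes "square_integrable M f" "square_integrable M g"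
  shows "(\<integral>x. (f x + g x)\<^sup>2 \<partial>M) \<le> 2 * (\<integral>x. (f x)\<^sup>2 \<partial>M) + 2 * (\<integral>x. (g x)\<^sup>2 \<partial>M)"
proof -
  have int: "integrable M (\<lambda>x. (f x)\<^sup>2)" "integrable M (\<lambda>x. (g x)\<^sup>2)"
    using assms by (auto simp: square_integrable_def)
  have "(\<integral>x. (f x + g x)\<^sup>2 \<partial>M) \<le> (\<integral>x. 2 * (f x)\<^sup>2 + 2 * (g x)\<^sup>2 \<partial>M)"
    using square_integrable_add[OF assms] int
    by (intro integral_mono) (auto simp: square_integrable_def square_add_le)
  then show ?thesis using int by simp
qed

lemma (in finite_measure) square_integrable_bounded:
  assumes "f \<in> borel_measurable M" "AE x in M. \<bar>f x\<bar> \<le> (B :: real)"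
  shows "square_integrable M f"
proof -
  have "integrable M (\<lambda>x. (f x)\<^sup>2)"
  proof (rule integrable_const_bound[where B = "B\<^sup>2"])
    show "AE x in M. norm ((f x)\<^sup>2) \<le> B\<^sup>2"
      using assms(2) by eventually_elim (metis abs_ge_zero norm_power power2_abs power_mono real_norm_def)
  qed (use assms(1) in measurable)
  then show ?thesis using assms(1) by (simp add: square_integrable_def)
qed

text \<open>\<open>P k\<close> is an approximation of \<open>Z\<close> that is easy to pass to the limit; the error is small in
  \<open>L\<^sup>2\<close> and, by a maximal inequality, uniformly in time with large probability.\<close>

lemma (in prob_space) convergence_by_approximation:
  fixes Z :: "nat \<Rightarrow> 'a \<Rightarrow> real" and P :: "nat \<Rightarrow> nat \<Rightarrow> 'a \<Rightarrow> real" and Y :: "nat \<Rightarrow> 'a \<Rightarrow> real"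
  assumes Z [measurable]: "\<And>n. Z n \<in> borel_measurable M"
    and P [measurable]: "\<And>k n. P k n \<in> borel_measurable M"
    and Y [measurable]: "\<And>k. Y k \<in> borel_measurable M"
    and lim: "\<And>k. AE x in M. (\<lambda>n. P k n x) \<longlonglongrightarrow> Y k x"
    and bound: "\<And>k n. AE x in M. \<bar>P k n x\<bar> \<le> B k"
    and r: "summable r"
    and error_int: "\<And>k n. integrable M (\<lambda>x. (Z n x - P k n x)\<^sup>2)"
    and error: "\<And>k n. (\<integral>x. (Z n x - P k n x)\<^sup>2 \<partial>M) \<le> r k"
    and maximal: "\<And>k n e. 0 < e \<Longrightarrow>
      e\<^sup>2 * prob {x\<in>space M. \<exists>i\<le>n. e \<le> \<bar>Z i x - P k i x\<bar>} \<le> r k"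
  shows "AE x in M. (\<lambda>k. Y k x) \<longlonglongrightarrow> lim (\<lambda>k. Y k x)"
    and "AE x in M. (\<lambda>n. Z n x) \<longlonglongrightarrow> lim (\<lambda>k. Y k x)"
    and "converges_L2 M Y (\<lambda>x. lim (\<lambda>k. Y k x))"
    and "converges_L2 M Z (\<lambda>x. lim (\<lambda>k. Y k x))"
proof -
  let ?L = "\<lambda>x. lim (\<lambda>k. Y k x)"
  have [measurable]: "?L \<in> borel_measurable M" by (rule borel_measurable_lim_metric) simp
  have "AE x in M. \<forall>\<^sub>F k in sequentially. \<forall>n. \<bar>Z n x - P k n x\<bar> < e" if "0 < e" for e
  proof -
    \<comment> \<open>The sets increase with \<open>n\<close>; their union is the event that the
      error at depth \<open>k\<close> ever reaches \<open>e\<close>, to which Borel-Cantelli is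
      applied in \<open>k\<close>.\<close>
    define A where "A k n = {x\<in>space M. \<exists>i\<le>n. e \<le> \<bar>Z i x - P k i x\<bar>}" for k n
    have [measurable]: "A k n \<in> events" for k n unfolding A_def by measurable
    have prob_le: "prob (\<Union>n. A k n) \<le> r k / e\<^sup>2" for k
    proof (rule LIMSEQ_le_const2)
      show "(\<lambda>n. prob (A k n)) \<longlonglongrightarrow> prob (\<Union>n. A k n)"
        by (intro finite_Lim_measure_incseq) (auto simp: incseq_def A_def intro: order.trans)
      show "\<exists>N. \<forall>n\<ge>N. prob (A k n) \<le> r k / e\<^sup>2"
        using maximal[OF that] that by (auto simp: A_def pos_le_divide_eq mult.commute)
    qed
    have "AE x in M. \<forall>\<^sub>F k in sequentially. x \<in> space M - (\<Union>n. A k n)"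
    proof (rule borel_cantelli_AE1)
      show "summable (\<lambda>k. prob (\<Union>n. A k n))"
        by (rule summable_comparison_test'[OF summable_divide[OF r, of "e\<^sup>2"], of 0]) (simp add: prob_le)
    qed (auto simp: emeasure_eq_measure)
    then show ?thesis
      by eventually_elim (auto elim!: eventually_mono simp: A_def not_le)
  qed
  then have "AE x in M. \<forall>m. \<forall>\<^sub>F k in sequentially. \<forall>n. \<bar>Z n x - P k n x\<bar> < 1 / real (Suc m)"
    by (auto simp: AE_all_countable)
  moreover have lim_all: "AE x in M. \<forall>k. (\<lambda>n. P k n x) \<longlonglongrightarrow> Y k x"
    using lim by (auto simp: AE_all_countable)
  ultimately have both: "AE x in M. (\<lambda>k. Y k x) \<longlonglongrightarrow> ?L x \<and> (\<lambda>n. Z n x) \<longlonglongrightarrow> ?L x"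
  proof eventually_elim
    case (elim x)
    then show ?case
      using uniform_approximation_limit[of "\<lambda>k n. P k n x" "\<lambda>k. Y k x" "\<lambda>n. Z n x"] by blast
  qed
  then show Y_AE: "AE x in M. (\<lambda>k. Y k x) \<longlonglongrightarrow> ?L x"
    and Z_AE: "AE x in M. (\<lambda>n. Z n x) \<longlonglongrightarrow> ?L x"
    by (auto elim!: eventually_mono)
  have tail: "AE x in M. (\<lambda>n. Z n x - P k n x) \<longlonglongrightarrow> ?L x - Y k x" for k
    using Z_AE lim[of k] by eventually_elim (rule tendsto_diff)
  \<comment> \<open>Fatou in n at fixed \<open>k\<close>: the error bound survives in the limit and
    controls the tail of the series.\<close>
  have LY: "integrable M (\<lambda>x. (?L x - Y k x)\<^sup>2)" "(\<integral>x. (?L x - Y k x)\<^sup>2 \<partial>M) \<le> r k" for k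
    by (rule L2_Fatou[OF _ _ tail error_int error]; simp)+
  have Y_bound: "AE x in M. \<bar>Y k x\<bar> \<le> B k" for k
  proof -
    have "AE x in M. \<forall>n. \<bar>P k n x\<bar> \<le> B k" using bound by (simp add: AE_all_countable)
    then show ?thesis using lim[of k]
      by eventually_elim (rule LIMSEQ_le_const2[OF tendsto_rabs], auto)
  qed
  have sq_Y: "square_integrable M (Y k)" for k
    by (rule square_integrable_bounded[OF Y Y_bound])
  have sq_LY: "square_integrable M (\<lambda>x. ?L x - Y k x)" for k
    using LY(1) by (simp add: square_integrable_def)
  have sq_L: "square_integrable M ?L"
    using square_integrable_add[OF sq_LY[of 0] sq_Y[of 0]] by simp
  have sq_Z: "square_integrable M (Z n)" for n
    using square_integrable_add[of M "\<lambda>x. Z n x - P 0 n x" "P 0 n"]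
      square_integrable_bounded[OF P bound, of 0 n] error_int[of n 0]
    by (simp add: square_integrable_def)
  have "(\<lambda>k. \<integral>x. (Y k x - ?L x)\<^sup>2 \<partial>M) \<longlonglongrightarrow> 0"
  proof (rule tendsto_sandwich[OF _ _ tendsto_const summable_LIMSEQ_zero[OF r]])
    show "\<forall>\<^sub>F k in sequentially. (\<integral>x. (Y k x - ?L x)\<^sup>2 \<partial>M) \<le> r k"
      using LY(2) by (simp add: power2_commute)
  qed simp
  then show "converges_L2 M Y ?L"
    using sq_Y sq_L by (simp add: converges_L2_def)
  \<comment> \<open>At fixed depth everything is bounded by \<open>B k\<close>, so dominated
    convergence suffices.\<close>
  have PY: "(\<lambda>n. \<integral>x. (P k n x - Y k x)\<^sup>2 \<partial>M) \<longlonglongrightarrow> 0" for k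
  proof -
    have "(\<lambda>n. \<integral>x. (P k n x - Y k x)\<^sup>2 \<partial>M) \<longlonglongrightarrow> (\<integral>x. 0 \<partial>M)"
    proof (rule integral_dominated_convergence[where w = "\<lambda>_. (2 * B k)\<^sup>2"])
      show "AE x in M. (\<lambda>n. (P k n x - Y k x)\<^sup>2) \<longlonglongrightarrow> 0"
        using lim[of k]
      proof eventually_elim
        case (elim x)
        then have "(\<lambda>n. (P k n x - Y k x)\<^sup>2) \<longlonglongrightarrow> (Y k x - Y k x)\<^sup>2" by (intro tendsto_intros)
        then show ?case by simp
      qed
      show "AE x in M. norm ((P k n x - Y k x)\<^sup>2) \<le> (2 * B k)\<^sup>2" for n
        using bound[of k n] Y_bound[of k]
      proof eventually_elim
        case (elim x)
        then have "\<bar>P k n x - Y k x\<bar> \<le> \<bar>2 * B k\<bar>" by linarith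
        then show ?case by (simp only: abs_le_square_iff real_norm_def abs_power2)
      qed
    qed simp_all
    then show ?thesis by simp
  qed
  have "(\<lambda>n. \<integral>x. (Z n x - ?L x)\<^sup>2 \<partial>M) \<longlonglongrightarrow> 0"
  proof (rule metric_LIMSEQ_I)
    fix e :: real assume "0 < e"
    \<comment> \<open>Splitting the square twice gives the three errors the weights 2, 4 and 4, and
      10 < 12.\<close>
    then obtain k where k: "r k < e / 12"
      using order_tendstoD(2)[OF summable_LIMSEQ_zero[OF r], of "e / 12"]
      by (auto simp: eventually_sequentially)
    obtain N where N: "\<And>n. N \<le> n \<Longrightarrow> (\<integral>x. (P k n x - Y k x)\<^sup>2 \<partial>M) < e / 12"
      using order_tendstoD(2)[OF PY[of k], of "e / 12"] \<open>0 < e\<close>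
      by (auto simp: eventually_sequentially)
    have "dist (\<integral>x. (Z n x - ?L x)\<^sup>2 \<partial>M) 0 < e" if "N \<le> n" for n
    proof -
      have sq1: "square_integrable M (\<lambda>x. Z n x - P k n x)"
        using error_int by (simp add: square_integrable_def)
      have "AE x in M. \<bar>P k n x - Y k x\<bar> \<le> 2 * B k"
        using bound[of k n] Y_bound[of k] by eventually_elim linarith
      then have sq2: "square_integrable M (\<lambda>x. P k n x - Y k x)"
        by (intro square_integrable_bounded) simp_all
      have sq3: "square_integrable M (\<lambda>x. Y k x - ?L x)"
        using sq_LY by (simp add: square_integrable_def power2_commute)
      have "(\<integral>x. (Z n x - ?L x)\<^sup>2 \<partial>M) \<le> 2 * (\<integral>x. (Z n x - P k n x)\<^sup>2 \<partial>M)
          + 2 * (\<integral>x. ((P k n x - Y k x) + (Y k x - ?L x))\<^sup>2 \<partial>M)"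
        using square_integrable_integral_add_le[OF sq1 square_integrable_add[OF sq2 sq3]] by simp
      also have "(\<integral>x. ((P k n x - Y k x) + (Y k x - ?L x))\<^sup>2 \<partial>M) \<le>
          2 * (\<integral>x. (P k n x - Y k x)\<^sup>2 \<partial>M) + 2 * (\<integral>x. (Y k x - ?L x)\<^sup>2 \<partial>M)"
        by (rule square_integrable_integral_add_le[OF sq2 sq3])
      finally have "(\<integral>x. (Z n x - ?L x)\<^sup>2 \<partial>M) < e"
        using error[of n k] N[OF that] LY(2)[of k] k \<open>0 < e\<close> by (simp add: power2_commute[of "Y k _"])
      moreover have "0 \<le> (\<integral>x. (Z n x - ?L x)\<^sup>2 \<partial>M)" by simp
      ultimately show ?thesis by (simp add: dist_real_def)
    qed
    then show "\<exists>N. \<forall>n\<ge>N. dist (\<integral>x. (Z n x - ?L x)\<^sup>2 \<partial>M) 0 < e" by blast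
  qed
  then show "converges_L2 M Z ?L"
    using sq_Z sq_L by (simp add: converges_L2_def)
qed

subsection \<open>Limits of subtree sizes and tolls\<close>

text \<open>The meet has length m < |u|. The point x has length at least m + 1 while y may end at
  the meet, so the distance is at least 2^(-m) (1 - 1/4 - 1/2).\<close>

lemma dist_bnode_prefix:
  assumes "is_prefix u x" "\<not> is_prefix u y"
  shows "(1 / 2) ^ length u / 4 \<le> dist x y"
proof -
  have "\<not> enat (length u) \<le> meet_length x y"
    unfolding le_meet_length_iff using assms is_prefix_unique by metis
  then obtain m where m: "meet_length x y = enat m" "m < length u"
    by (cases "meet_length x y") auto
  have "enat (Suc m) \<le> bnode_length x"
    using is_prefix_length[OF assms(1)] m(2) order_trans[of "enat (Suc m)" "enat (length u)"] by simp
  then have "neg_pow2 (bnode_length x) \<le> (1 / 2) ^ Suc m"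
    using neg_pow2_antimono[of "enat (Suc m)"] by simp
  moreover have "neg_pow2 (bnode_length y) \<le> (1 / 2) ^ m"
    using neg_pow2_antimono[OF meet_length_le[of y x]] m(1) by (simp add: meet_length_commute)
  ultimately have "(1 / 2) ^ m / 4 \<le> dist x y"
    by (simp add: dist_bnode_def m(1))
  moreover have "(1 / 2 :: real) ^ length u \<le> (1 / 2) ^ m"
    using m(2) by (intro power_decreasing) auto
  ultimately show ?thesis by linarith
qed

lemma is_prefix_dist_iff:
  assumes "dist x y < (1 / 2) ^ length u / 4"
  shows "is_prefix u x \<longleftrightarrow> is_prefix u y"
  using assms dist_bnode_prefix[of u x y] dist_bnode_prefix[of u y x] by (auto simp: dist_commute)

lemma open_prefix: "open {v. is_prefix u v}"
  unfolding open_dist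
proof (intro ballI exI conjI allI impI)
  fix x y assume "x \<in> {v. is_prefix u v}" "dist y x < (1 / 2) ^ length u / 4"
  then show "y \<in> {v. is_prefix u v}" using is_prefix_dist_iff[of y x u] by simp
qed simp

text \<open>Being a prefix is constant on small balls, so this indicator is an admissible test
  function for weak convergence.\<close>

lemma continuous_on_prefix_indicator:
  "continuous_on UNIV (indicator {v. is_prefix u v} :: bnode \<Rightarrow> real)"
  unfolding continuous_on_iff
proof (intro ballI allI impI)
  fix x :: bnode and e :: real assume "0 < e"
  have "dist (indicator {v. is_prefix u v} y :: real) (indicator {v. is_prefix u v} x) < e"
    if "dist y x < (1 / 2) ^ length u / 4" for y
    using is_prefix_dist_iff[OF that] \<open>0 < e\<close> by (simp add: indicator_def)
  then show "\<exists>d>0. \<forall>y\<in>UNIV. dist y x < d \<longrightarrow>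
      dist (indicator {v. is_prefix u v} y :: real) (indicator {v. is_prefix u v} x) < e"
    by (intro exI[of _ "(1 / 2) ^ length u / 4"]) simp
qed

lemma cyl_eq: "cyl u = boundary \<inter> {v. is_prefix u v}"
  by (auto simp: cyl_def)

lemma cyl_in_sets: "cyl u \<in> sets (restrict_space borel boundary)"
  using open_prefix[of u] by (auto simp: cyl_eq sets_restrict_space)

lemma fringe_size_limit:
  assumes conv: "unif_weakly_converges x \<mu>"
    and sets: "sets \<mu> = sets (restrict_space borel boundary)"
    and x: "\<And>n. 1 \<le> n \<Longrightarrow> is_tree (x n) \<and> card (x n) = n"
  shows "(\<lambda>n. real (fringe_size (x n) u) / real n) \<longlonglongrightarrow> measure \<mu> (cyl u)"
proof -
  let ?f = "indicator {v. is_prefix u v} :: bnode \<Rightarrow> real"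
  have "bounded (range ?f)"
    by (rule boundedI[of _ 1]) (auto simp: indicator_def)
  then have "(\<lambda>n. measure_pmf.expectation (pmf_of_set (Node ` x n)) ?f) \<longlonglongrightarrow> integral\<^sup>L \<mu> ?f"
    using conv continuous_on_prefix_indicator unfolding unif_weakly_converges_def by blast
  moreover have "\<forall>\<^sub>F n in sequentially. measure_pmf.expectation (pmf_of_set (Node ` x n)) ?f =
      real (fringe_size (x n) u) / real n"
    using eventually_ge_at_top[of 1]
  proof eventually_elim
    case (elim n)
    then have "finite (x n)" "x n \<noteq> {}" "card (x n) = n"
      using x[of n] is_treeD(1,2)[of "x n"] by auto
    moreover have "(\<Sum>v\<in>x n. indicator {v. is_prefix u v} (Node v) :: real) = real (fringe_size (x n) u)"
      using \<open>finite (x n)\<close> by (simp add: indicator_def fringe_size_def Int_def flip: of_bool_def)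
    moreover have "measure_pmf.expectation (pmf_of_set (Node ` x n)) ?f =
        (\<Sum>v\<in>Node ` x n. ?f v) / real (card (Node ` x n))"
      using \<open>finite (x n)\<close> \<open>x n \<noteq> {}\<close> by (intro integral_pmf_of_set) auto
    ultimately show ?case
      by (simp only:) (simp add: sum.reindex inj_on_def card_image)
  qed
  moreover have "integral\<^sup>L \<mu> ?f = measure \<mu> (cyl u)"
  proof -
    have "space \<mu> = boundary"
      using sets_eq_imp_space_eq[OF sets] by (simp add: space_restrict_space)
    then show ?thesis by (simp add: cyl_eq Int_commute)
  qed
  ultimately show ?thesis by (simp add: tendsto_cong)
qed

text \<open>The sequence c need not tend to infinity, so the hypothesis cannot simply be composed
  with it.\<close>

lemma sublinear_compose:
  fixes e :: "nat \<Rightarrow> real"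
  assumes e: "(\<lambda>m. e m / real m) \<longlonglongrightarrow> 0" and c: "\<And>n. 1 \<le> n \<Longrightarrow> c n \<le> n"
  shows "(\<lambda>n. e (c n) / real n) \<longlonglongrightarrow> 0"
proof (rule metric_LIMSEQ_I)
  fix r :: real assume "0 < r"
  then obtain M where M: "\<And>m. M \<le> m \<Longrightarrow> \<bar>e m / real m\<bar> < r / 2"
    using metric_LIMSEQ_D[OF e, of "r / 2"] by (auto simp: dist_real_def)
  \<comment> \<open>\<open>K\<close> absorbs the finitely many arguments at which the small slope
    r/2 is not yet available.\<close>
  define K where "K = (\<Sum>m\<le>M. \<bar>e m\<bar>)"
  have "0 \<le> K" by (simp add: K_def sum_nonneg)
  have bound: "\<bar>e m\<bar> \<le> r / 2 * real m + K" for m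
  proof (cases "m \<le> M")
    case True
    then have "\<bar>e m\<bar> \<le> K" unfolding K_def by (intro member_le_sum) auto
    then show ?thesis using \<open>0 < r\<close> by (simp add: add_increasing)
  next
    case False
    then have "\<bar>e m\<bar> / real m < r / 2" "0 < m" using M[of m] by auto
    then show ?thesis using \<open>0 \<le> K\<close> by (simp add: pos_divide_less_eq add_increasing2)
  qed
  obtain N where N: "2 * K / r < real N" using reals_Archimedean2 by blast
  have "dist (e (c n) / real n) 0 < r" if n: "Suc N \<le> n" for n
  proof -
    have "\<bar>e (c n)\<bar> \<le> r / 2 * real n + K"
    proof -
      have "r / 2 * real (c n) \<le> r / 2 * real n"
        using c[of n] n \<open>0 < r\<close> by (intro mult_left_mono) auto
      then show ?thesis using bound[of "c n"] by linarith
    qed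
    moreover have "2 * K / r < real n" using N n by linarith
    then have "2 * K < real n * r" using \<open>0 < r\<close> by (simp add: pos_divide_less_eq)
    ultimately have "\<bar>e (c n)\<bar> < r * real n" by (simp add: algebra_simps)
    then show ?thesis using n by (simp add: dist_real_def pos_divide_less_eq)
  qed
  then show "\<exists>N. \<forall>n\<ge>N. dist (e (c n) / real n) 0 < r" by blast
qed

lemma harm_sublinear: "(\<lambda>m. harm m / real m) \<longlonglongrightarrow> (0 :: real)"
proof -
  have "(\<lambda>m. (harm m - ln (real m)) * (1 / real m) + ln (real m) / real m) \<longlonglongrightarrow> euler_mascheroni * 0 + (0 :: real)"
    by (intro tendsto_intros euler_mascheroni_LIMSEQ lim_1_over_n)
  then show ?thesis by (simp add: field_simps diff_divide_distrib add_divide_distrib)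
qed

lemma harm_expansion_error:
  "(\<lambda>m. ((real m + 1) * harm m - real m * ln (real m) - euler_mascheroni * real m) / real m) \<longlonglongrightarrow> 0"
proof -
  have "(\<lambda>m. (harm m - ln (real m)) - euler_mascheroni + harm m / real m)
      \<longlonglongrightarrow> euler_mascheroni - euler_mascheroni + (0 :: real)"
    by (intro tendsto_intros euler_mascheroni_LIMSEQ harm_sublinear)
  moreover have "\<forall>\<^sub>F m in sequentially. (harm m - ln (real m)) - euler_mascheroni + harm m / real m =
      ((real m + 1) * harm m - real m * ln (real m) - euler_mascheroni * real m) / real m"
    using eventually_gt_at_top[of 0] by eventually_elim (simp add: field_simps)
  ultimately show ?thesis by (simp add: tendsto_cong)
qed

text \<open>Continuity at 0 is what covers children whose limiting mass is 0.\<close>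

lemma continuous_on_x_ln_x: "continuous_on {0..} (\<lambda>x :: real. x * ln x)"
  unfolding continuous_on_def
proof
  fix x :: real assume "x \<in> {0..}"
  show "((\<lambda>x. x * ln x) \<longlongrightarrow> x * ln x) (at x within {0..})"
  proof (cases "x = 0")
    case True
    have "((\<lambda>y :: real. - (ln y / y)) \<longlongrightarrow> - 0) at_top"
      by (intro tendsto_intros ln_x_over_x_tendsto_0)
    then have "((\<lambda>y :: real. - (ln y / y)) \<longlongrightarrow> 0) at_top"
      by (simp only: minus_zero)
    then have "((\<lambda>y :: real. inverse y * ln (inverse y)) \<longlongrightarrow> 0) at_top"
      by (rule Lim_transform_eventually)
         (use eventually_gt_at_top[of 0] in \<open>eventually_elim, simp add: ln_inverse divide_inverse mult.commute\<close>)
    then have "((\<lambda>y :: real. y * ln y) \<longlongrightarrow> 0) (at_right 0)"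
      by (simp add: filterlim_at_right_to_top)
    moreover have "at 0 within {0..} = at_right (0 :: real)"
      by (rule at_within_Ici_at_right)
    ultimately show ?thesis using True by simp
  next
    case False
    then have "isCont (\<lambda>x. x * ln x) x" by (intro continuous_intros) auto
    then show ?thesis
      using continuous_at_imp_continuous_at_within continuous_within by blast
  qed
qed

text \<open>With (k + 1) H_k = k ln k + gamma k + o(k), the terms in ln n and gamma cancel up to a
  coefficient -1/n, since c + d - s = -1. What remains is an entropy of the limiting masses.\<close>

lemma toll_limit:
  assumes x: "\<And>n. 1 \<le> n \<Longrightarrow> is_tree (x n) \<and> card (x n) = n"
    and m: "\<And>u. (\<lambda>n. real (fringe_size (x n) u) / real n) \<longlonglongrightarrow> m u"
  shows "(\<lambda>n. toll (x n) u / real n) \<longlonglongrightarrow> m u * C (m (u @ [False]) / m u)"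
proof (cases "m u = 0")
  \<comment> \<open>The argument of \<open>C\<close> is then a division by 0, but its value is
    multiplied by 0; the linear bound on the toll gives the limit.\<close>
  case True
  have "(\<lambda>n. 4 * (real (fringe_size (x n) u) / real n)) \<longlonglongrightarrow> 4 * m u"
    by (intro tendsto_intros m)
  then have "(\<lambda>n. 4 * (real (fringe_size (x n) u) / real n)) \<longlonglongrightarrow> 0"
    using True by simp
  moreover have "\<forall>\<^sub>F n in sequentially. norm (toll (x n) u / real n) \<le> 4 * (real (fringe_size (x n) u) / real n)"
    using eventually_ge_at_top[of 1]
  proof eventually_elim
    case (elim n)
    then show ?case using x[of n] abs_toll_le[of "x n" u] by (simp add: divide_right_mono)
  qed
  ultimately show ?thesis using True by (simp add: Lim_null_comparison)
next
  case False
  define c d s where "c n = fringe_size (x n) (u @ [False])"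
    and "d n = fringe_size (x n) (u @ [True])" and "s n = fringe_size (x n) u" for n
  define \<eta> where "\<eta> y = y * ln y" for y :: real
  define e where "e k = (real k + 1) * harm k - real k * ln (real k) - euler_mascheroni * real k" for k :: nat
  have le: "c n \<le> n" "d n \<le> n" "s n \<le> n" if "1 \<le> n" for n
    using x[OF that] is_treeD(1)[of "x n"] fringe_size_le[of "x n"] by (auto simp: c_def d_def s_def)
  have nonneg: "0 \<le> m v" for v
    by (rule LIMSEQ_le_const[OF m]) auto
  then have "0 < m u" using False by (simp add: order_less_le)
  have mem: "\<forall>\<^sub>F n in sequentially. 1 \<le> n \<and> u \<in> x n"
    using order_tendstoD(1)[OF m \<open>0 < m u\<close>] eventually_ge_at_top[of 1]
  proof eventually_elim
    case (elim n)
    then show ?case using fringe_size_notin[of "x n" u] x[of n] by fastforce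
  qed
  have s_eq: "\<forall>\<^sub>F n in sequentially. s n = c n + d n + 1"
    using mem by eventually_elim (use x fringe_size_split[of "x _" u False] in \<open>auto simp: c_def d_def s_def\<close>)
  have lims: "(\<lambda>n. real (c n) / real n) \<longlonglongrightarrow> m (u @ [False])"
    "(\<lambda>n. real (d n) / real n) \<longlonglongrightarrow> m (u @ [True])" "(\<lambda>n. real (s n) / real n) \<longlonglongrightarrow> m u"
    using m by (simp_all add: c_def d_def s_def)
  have "(\<lambda>n. real (c n) / real n + real (d n) / real n + 1 / real n) \<longlonglongrightarrow> m (u @ [False]) + m (u @ [True]) + 0"
    by (intro tendsto_intros lims lim_1_over_n)
  moreover have "\<forall>\<^sub>F n in sequentially. real (c n) / real n + real (d n) / real n + 1 / real n = real (s n) / real n"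
    using s_eq by eventually_elim (simp add: add_divide_distrib)
  ultimately have "(\<lambda>n. real (s n) / real n) \<longlonglongrightarrow> m (u @ [False]) + m (u @ [True])"
    by (simp add: tendsto_cong)
  then have m_add: "m u = m (u @ [False]) + m (u @ [True])"
    using lims(3) LIMSEQ_unique by blast
  have \<eta>_lim: "(\<lambda>n. \<eta> (real (f n) / real n)) \<longlonglongrightarrow> \<eta> l"
    if "(\<lambda>n. real (f n) / real n) \<longlonglongrightarrow> l" for f l
    unfolding \<eta>_def
    by (rule continuous_on_tendsto_compose[OF continuous_on_x_ln_x that])
       (auto intro: LIMSEQ_le_const[OF that])
  have e_lim: "(\<lambda>n. e (f n) / real n) \<longlonglongrightarrow> 0" if "\<And>n. 1 \<le> n \<Longrightarrow> f n \<le> n" for f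
    using harm_expansion_error that unfolding e_def[symmetric] by (rule sublinear_compose)
  \<comment> \<open>Rescaling: k ln k / n is \<open>\<eta> (k / n)\<close> plus (k / n) ln
    n.\<close>
  have harm_eq: "(real k + 1) * harm k / real n =
      e k / real n + \<eta> (real k / real n) + real k / real n * (ln (real n) + euler_mascheroni)"
    if "1 \<le> n" for k n :: nat
    using that by (cases "k = 0") (simp_all add: e_def \<eta>_def harm_expand ln_div field_simps)
  have "(\<lambda>n. real (s n) / real n + 3 * (1 / real n) + 2 * (
        (e (c n) / real n + e (d n) / real n - e (s n) / real n)
      + (\<eta> (real (c n) / real n) + \<eta> (real (d n) / real n) - \<eta> (real (s n) / real n))
      - (ln (real n) / real n + euler_mascheroni * (1 / real n))))
    \<longlonglongrightarrow> m u + 3 * 0 + 2 * ((0 + 0 - 0) + (\<eta> (m (u @ [False])) + \<eta> (m (u @ [True])) - \<eta> (m u))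
      - (0 + euler_mascheroni * 0))"
    by (intro tendsto_intros lims \<eta>_lim e_lim lim_1_over_n lim_ln_over_n le)
  moreover have "\<forall>\<^sub>F n in sequentially. real (s n) / real n + 3 * (1 / real n) + 2 * (
        (e (c n) / real n + e (d n) / real n - e (s n) / real n)
      + (\<eta> (real (c n) / real n) + \<eta> (real (d n) / real n) - \<eta> (real (s n) / real n))
      - (ln (real n) / real n + euler_mascheroni * (1 / real n))) = toll (x n) u / real n"
    using mem s_eq
  proof eventually_elim
    case (elim n)
    then have n: "1 \<le> n" and s: "real (s n) = real (c n) + real (d n) + 1" by auto
    have "toll (x n) u / real n = (real (s n) + 3 + 2 * ((real (c n) + 1) * harm (c n)
        + (real (d n) + 1) * harm (d n) - (real (s n) + 1) * harm (s n))) / real n"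
      using elim by (simp add: toll_def split_toll_eq c_def d_def)
    also have "\<dots> = real (s n) / real n + 3 / real n + 2 * ((real (c n) + 1) * harm (c n) / real n
        + (real (d n) + 1) * harm (d n) / real n - (real (s n) + 1) * harm (s n) / real n)"
      by (simp add: add_divide_distrib diff_divide_distrib)
    also have "\<dots> = real (s n) / real n + 3 / real n + 2 * (
        (e (c n) / real n + e (d n) / real n - e (s n) / real n)
      + (\<eta> (real (c n) / real n) + \<eta> (real (d n) / real n) - \<eta> (real (s n) / real n))
      + (real (c n) / real n + real (d n) / real n - real (s n) / real n) * (ln (real n) + euler_mascheroni))"
      unfolding harm_eq[OF n] by (simp add: algebra_simps)
    also have "real (c n) / real n + real (d n) / real n - real (s n) / real n = - (1 / real n)"
      by (simp add: s add_divide_distrib)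
    finally show ?case by (simp add: algebra_simps)
  qed
  moreover have "m u + 2 * (\<eta> (m (u @ [False])) + \<eta> (m (u @ [True])) - \<eta> (m u)) =
      m u * C (m (u @ [False]) / m u)"
  proof -
    have scale: "m u * (a / m u * ln (a / m u)) = \<eta> a - a * ln (m u)" if "0 \<le> a" for a
      using that \<open>0 < m u\<close> by (cases "a = 0") (simp_all add: \<eta>_def ln_div right_diff_distrib)
    have "1 - m (u @ [False]) / m u = m (u @ [True]) / m u"
      using m_add \<open>0 < m u\<close> by (simp add: field_simps)
    then have "m u * C (m (u @ [False]) / m u) = m u + 2 *
        (m u * (m (u @ [False]) / m u * ln (m (u @ [False]) / m u))
        + m u * (m (u @ [True]) / m u * ln (m (u @ [True]) / m u)))"
      by (simp only: C_def) (simp add: distrib_left)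
    then have "m u * C (m (u @ [False]) / m u) = m u + 2 *
        ((\<eta> (m (u @ [False])) - m (u @ [False]) * ln (m u)) + (\<eta> (m (u @ [True])) - m (u @ [True]) * ln (m u)))"
      by (simp only: scale[OF nonneg])
    moreover have "m (u @ [False]) * ln (m u) + m (u @ [True]) * ln (m u) = \<eta> (m u)"
      by (metis \<eta>_def distrib_right m_add)
    ultimately show ?thesis by simp
  qed
  ultimately show ?thesis by (simp add: tendsto_cong)
qed

text \<open>The source of the constant: H_n - ln n tends to gamma, and the summand - 4 n of
  \<open>mean_IPL\<close> gives -4.\<close>

lemma mean_IPL_limit:
  "(\<lambda>n. mean_IPL n / real n - 2 * ln (real n)) \<longlonglongrightarrow> 2 * euler_mascheroni - 4"
proof -
  have lim: "(\<lambda>n. 2 * (harm n - ln (real n)) + 2 * (harm n / real n) - 4) \<longlonglongrightarrow> 2 * euler_mascheroni + 2 * 0 - (4 :: real)"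
    by (intro tendsto_intros euler_mascheroni_LIMSEQ harm_sublinear)
  have eq: "\<forall>\<^sub>F n in sequentially. 2 * (harm n - ln (real n)) + 2 * (harm n / real n) - 4 =
      mean_IPL n / real n - 2 * ln (real n)"
    using eventually_gt_at_top[of 0] by eventually_elim (simp add: mean_IPL_def field_simps)
  show ?thesis using Lim_transform_eventually[OF lim eq] by simp
qed

subsection \<open>The chain on the probability space\<close>

locale bst_process = prob_space M for M :: "'a measure" +
  fixes X :: "nat \<Rightarrow> 'a \<Rightarrow> bool list set"
  assumes chain: "bst_chain M X"
begin

definition path :: "nat \<Rightarrow> 'a \<Rightarrow> bool list set list" where
  "path n \<omega> = map (\<lambda>i. X (Suc i) \<omega>) [0..<Suc n]"

lemma last_path: "last (path n \<omega>) = X (Suc n) \<omega>"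
  by (simp add: path_def)

lemma path_eq_iff: "path n \<omega> = p \<longleftrightarrow> length p = Suc n \<and> (\<forall>i\<in>{1..Suc n}. X i \<omega> = p ! (i - 1))"
proof -
  have "path n \<omega> = p \<longleftrightarrow> length p = Suc n \<and> (\<forall>i<Suc n. X (Suc i) \<omega> = p ! i)"
    by (auto simp: path_def list_eq_iff_nth_eq simp del: upt_Suc)
  also have "(\<forall>i<Suc n. X (Suc i) \<omega> = p ! i) \<longleftrightarrow> (\<forall>i\<in>{1..Suc n}. X i \<omega> = p ! (i - 1))"
    by (auto simp: Ball_def gr0_conv_Suc Suc_le_eq)
  finally show ?thesis .
qed

text \<open>The state space is discrete, so every function of a single tree of the chain is a random
  variable.\<close>

lemma X_measurable: "X (Suc n) \<in> measurable M (count_space {x. is_tree x})"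
  using chain unfolding bst_chain_def is_tree_def by auto

lemma is_tree_X: "\<omega> \<in> space M \<Longrightarrow> is_tree (X (Suc n) \<omega>)"
  using measurable_space[OF X_measurable, of \<omega> n] by simp

lemma X_pred: "Measurable.pred M (\<lambda>\<omega>. Q (X (Suc n) \<omega>))"
  by (rule measurable_compose[OF X_measurable]) simp

lemma X_borel: "(\<lambda>\<omega>. f (X (Suc n) \<omega>) :: real) \<in> borel_measurable M"
  by (rule measurable_compose[OF X_measurable]) simp

lemma sets_path [measurable]: "{\<omega>\<in>space M. path n \<omega> = p} \<in> sets M"
proof (cases "length p = Suc n")
  case True
  have "{\<omega>\<in>space M. X (Suc i) \<omega> = x} \<in> sets M" for i x
  proof (cases "is_tree x")
    case True
    then have "X (Suc i) -` {x} \<inter> space M \<in> sets M"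
      by (intro measurable_sets[OF X_measurable]) simp
    also have "X (Suc i) -` {x} \<inter> space M = {\<omega>\<in>space M. X (Suc i) \<omega> = x}" by auto
    finally show ?thesis .
  next
    \<comment> \<open>The target of \<open>X\<close> contains only trees, so \<open>{x}\<close> is
      not a measurable set of it; the event is empty instead.\<close>
    case False
    then have "{\<omega>\<in>space M. X (Suc i) \<omega> = x} = {}" using is_tree_X by auto
    then show ?thesis by (metis sets.empty_sets)
  qed
  then have *: "{\<omega>\<in>space M. X i \<omega> = x} \<in> sets M" if "1 \<le> i" for i x
    using that by (cases i) auto
  have "{\<omega>\<in>space M. \<forall>i\<in>{1..Suc n}. X i \<omega> = p ! (i - 1)} \<in> sets M"
    by (intro sets.sets_Collect_finite_All' *) auto
  then show ?thesis using True by (simp add: path_eq_iff)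
next
  case False
  then have "{\<omega>\<in>space M. path n \<omega> = p} = {}" by (auto simp: path_eq_iff)
  then show ?thesis by (metis sets.empty_sets)
qed

lemma pmf_path_law_snoc:
  "pmf (path_law (Suc n)) (q @ [x]) = pmf (path_law n) q * pmf (bst_step (last q)) x"
proof -
  have "pmf (map_pmf (\<lambda>x. r @ [x]) (bst_step (last r))) (q @ [x]) =
      indicator {q} r * pmf (bst_step (last q)) x" for r
  proof (cases "r = q")
    case True
    then show ?thesis using pmf_map_inj'[of "\<lambda>x. q @ [x]"] by (simp add: inj_def)
  next
    case False
    then show ?thesis by (subst pmf_map_outside) auto
  qed
  then show ?thesis
    by (simp add: pmf_bind measure_pmf_single)
qed

text \<open>The product formula in \<open>bst_chain\<close> is the recursion of
  \<open>path_law\<close>; lists of the wrong length have probability 0 on both sides.\<close>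

lemma prob_path: "prob {\<omega>\<in>space M. path n \<omega> = p} = pmf (path_law n) p"
proof (induction n arbitrary: p)
  case 0
  have X1: "AE \<omega> in M. path 0 \<omega> = [{[]}]"
    using chain by (auto simp: bst_chain_def path_def)
  have "prob {\<omega>\<in>space M. path 0 \<omega> = p} = prob {\<omega>\<in>space M. [{[]}] = p}"
    by (rule measure_eq_AE) (use X1 in auto)
  then show ?case by (cases "p = [{[]}]") (auto simp: prob_space)
next
  case (Suc n)
  show ?case
  proof (cases p rule: rev_cases)
    case Nil
    then have "\<not> p \<in> set_pmf (path_law (Suc n))" using path_law_support by force
    then show ?thesis using Nil by (simp add: path_def pmf_eq_0_set_pmf)
  next
    case (snoc q x)
    show ?thesis
    proof (cases "length q = Suc n")
      case True
      have "prob {\<omega>\<in>space M. path (Suc n) \<omega> = p} =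
          prob {\<omega>\<in>space M. \<forall>i\<in>{1..Suc n + 1}. X i \<omega> = p ! (i - 1)}"
        using True snoc by (simp add: path_eq_iff)
      also have "\<dots> = prob {\<omega>\<in>space M. \<forall>i\<in>{1..Suc n}. X i \<omega> = p ! (i - 1)}
          * pmf (bst_step (p ! (Suc n - 1))) (p ! (Suc n + 1 - 1))"
        using chain unfolding bst_chain_def
        by (elim conjE) (drule spec[of _ "Suc n"], drule mp, simp,
            drule spec[of _ "\<lambda>i. p ! (i - 1)"], assumption)
      also have "{\<omega>\<in>space M. \<forall>i\<in>{1..Suc n}. X i \<omega> = p ! (i - 1)} = {\<omega>\<in>space M. path n \<omega> = q}"
        using True snoc by (intro Collect_cong) (auto simp: path_eq_iff nth_append)
      also have "p ! (Suc n - 1) = last q"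
        using True snoc last_conv_nth[of q] by (cases "q = []") (simp_all add: nth_append)
      also have "p ! (Suc n + 1 - 1) = x"
        using True snoc by (simp add: nth_append)
      finally show ?thesis using Suc snoc by (simp add: pmf_path_law_snoc del: path_law.simps)
    next
      case False
      then have "q \<notin> set_pmf (path_law n)" using path_law_support by blast
      then have "pmf (path_law n) q = 0" by (simp add: pmf_eq_0_set_pmf)
      moreover have "{\<omega>\<in>space M. path (Suc n) \<omega> = p} = {}"
        using False snoc by (auto simp: path_eq_iff)
      then have "prob {\<omega>\<in>space M. path (Suc n) \<omega> = p} = 0"
        by (simp only: measure_empty)
      ultimately show ?thesis
        using snoc by (simp add: pmf_path_law_snoc del: path_law.simps)
    qed
  qed
qed

lemma AE_path_law: "AE \<omega> in M. path n \<omega> \<in> set_pmf (path_law n)"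
proof -
  let ?S = "set_pmf (path_law n)"
  have eq: "{\<omega>\<in>space M. path n \<omega> \<in> ?S} = (\<Union>p\<in>?S. {\<omega>\<in>space M. path n \<omega> = p})" by auto
  have "prob (\<Union>p\<in>?S. {\<omega>\<in>space M. path n \<omega> = p}) = (\<Sum>p\<in>?S. pmf (path_law n) p)"
    by (subst finite_measure_finite_Union)
       (auto simp: finite_path_law disjoint_family_on_def prob_path)
  then have "prob {\<omega>\<in>space M. path n \<omega> \<in> ?S} = 1"
    by (simp add: eq sum_pmf_eq_1 finite_path_law)
  moreover have "{\<omega>\<in>space M. path n \<omega> \<in> ?S} \<in> sets M"
    unfolding eq by (intro sets.finite_UN finite_path_law sets_path)
  ultimately show ?thesis by (simp add: prob_Collect_eq_1)
qed

lemma AE_card_X: "AE \<omega> in M. \<forall>n\<ge>1. is_tree (X n \<omega>) \<and> card (X n \<omega>) = n"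
proof -
  have "AE \<omega> in M. \<forall>n. path n \<omega> \<in> set_pmf (path_law n)"
    using AE_path_law by (simp add: AE_all_countable)
  then show ?thesis
  proof eventually_elim
    case (elim \<omega>)
    then have "is_tree (X (Suc n) \<omega>) \<and> card (X (Suc n) \<omega>) = Suc n" for n
      using path_law_support[of "path n \<omega>" n] by (simp add: last_path)
    then show ?case by (auto simp: Suc_le_eq gr0_conv_Suc)
  qed
qed

text \<open>Almost surely the random variable is a finite combination of indicators of paths, so
  integrability comes for free.\<close>

lemma path_expectation:
  assumes [measurable]: "(\<lambda>\<omega>. f (path n \<omega>) :: real) \<in> borel_measurable M"
  shows "integrable M (\<lambda>\<omega>. f (path n \<omega>))" and "expectation (\<lambda>\<omega>. f (path n \<omega>)) = path_mean n f"
proof -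
  let ?S = "set_pmf (path_law n)"
  let ?g = "\<lambda>\<omega>. \<Sum>p\<in>?S. f p * indicator {\<omega>\<in>space M. path n \<omega> = p} \<omega>"
  have int: "integrable M (\<lambda>\<omega>. f p * indicator {\<omega>\<in>space M. path n \<omega> = p} \<omega>)" for p
    by (intro integrable_mult_right integrable_real_indicator) (auto simp: emeasure_eq_measure)
  then have int_g: "integrable M ?g" by (rule Bochner_Integration.integrable_sum)
  have AE_eq: "AE \<omega> in M. ?g \<omega> = f (path n \<omega>)"
    using AE_path_law[of n] AE_space
  proof eventually_elim
    case (elim \<omega>)
    have "?g \<omega> = (\<Sum>p\<in>?S. if p = path n \<omega> then f p else 0)"
      using elim by (intro sum.cong refl) (auto simp: indicator_def)
    then show ?case using elim by (simp add: finite_path_law)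
  qed
  show "integrable M (\<lambda>\<omega>. f (path n \<omega>))"
    using integrable_cong_AE_imp[OF int_g _ AE_eq] by simp
  have "expectation (\<lambda>\<omega>. f (path n \<omega>)) = expectation ?g"
    using AE_eq by (intro integral_cong_AE) (auto intro: borel_measurable_integrable[OF int_g])
  also have "\<dots> = (\<Sum>p\<in>?S. f p * pmf (path_law n) p)"
    using int by (subst Bochner_Integration.integral_sum) (auto simp: prob_path)
  also have "\<dots> = path_mean n f"
    by (rule integral_measure_pmf_real[symmetric]) (auto simp: finite_path_law)
  finally show "expectation (\<lambda>\<omega>. f (path n \<omega>)) = path_mean n f" .
qed

lemma expectation_toll_tail:
  shows "integrable M (\<lambda>\<omega>. (toll_tail k (X (Suc n) \<omega>) / real (Suc n))\<^sup>2)"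
    and "expectation (\<lambda>\<omega>. (toll_tail k (X (Suc n) \<omega>) / real (Suc n))\<^sup>2) \<le> 256 * (2 / 3) ^ k"
proof -
  let ?f = "\<lambda>x. (toll_tail k x / real (Suc n))\<^sup>2"
  have meas: "(\<lambda>\<omega>. ?f (last (path n \<omega>))) \<in> borel_measurable M"
    unfolding last_path by (rule X_borel)
  note E = path_expectation[of "\<lambda>p. ?f (last p)" n, OF meas, unfolded last_path]
  show "integrable M (\<lambda>\<omega>. ?f (X (Suc n) \<omega>))" by (rule E(1))
  have "expectation (\<lambda>\<omega>. ?f (X (Suc n) \<omega>)) = tree_mean n (\<lambda>x. (toll_tail k x)\<^sup>2) / (real (Suc n))\<^sup>2"
    unfolding E(2) by (simp add: power_divide)
  also have "\<dots> \<le> 32 * (real n + 2) * (real n + 3) * (2 / 3) ^ k / (real (Suc n))\<^sup>2"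
    by (intro divide_right_mono tree_mean_toll_tail_squared) simp
  also have "\<dots> \<le> 256 * (2 / 3) ^ k"
  proof -
    \<comment> \<open>The constant is generous in order to match the maximal inequality, where 4
      times 64 arises.\<close>
    have "32 * (real n + 2) * (real n + 3) \<le> 256 * (real (Suc n))\<^sup>2"
      by (simp add: power2_eq_square algebra_simps)
    then have "32 * (real n + 2) * (real n + 3) * (2 / 3) ^ k \<le> 256 * (real (Suc n))\<^sup>2 * (2 / 3) ^ k"
      by (rule mult_right_mono) simp
    then show ?thesis by (simp add: pos_divide_le_eq mult_ac)
  qed
  finally show "expectation (\<lambda>\<omega>. ?f (X (Suc n) \<omega>)) \<le> 256 * (2 / 3) ^ k" .
qed

text \<open>Doob's bound normalises by \<open>card x + 1\<close>. Dividing by \<open>card x\<close>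
  instead costs at most a factor 2, hence the level e / 2 and the factor 4.\<close>

lemma prob_toll_tail_maximal:
  assumes "0 < e"
  shows "e\<^sup>2 * prob {\<omega>\<in>space M. \<exists>i\<le>n. e \<le> \<bar>toll_tail k (X (Suc i) \<omega>) / real (Suc i)\<bar>} \<le> 256 * (2 / 3) ^ k"
proof -
  let ?A = "{\<omega>\<in>space M. \<exists>i\<le>n. e \<le> \<bar>toll_tail k (X (Suc i) \<omega>) / real (Suc i)\<bar>}"
  let ?P = "\<lambda>p. \<exists>x\<in>set p. e / 2 * (real (card x) + 1) \<le> \<bar>toll_tail k x\<bar>"
  have set_path: "set (path n \<omega>) = (\<lambda>i. X (Suc i) \<omega>) ` {..n}" for \<omega>
    by (auto simp: path_def simp del: upt_Suc)
  have path_iff: "?P (path n \<omega>) \<longleftrightarrow>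
      (\<exists>i\<le>n. e / 2 * (real (card (X (Suc i) \<omega>)) + 1) \<le> \<bar>toll_tail k (X (Suc i) \<omega>)\<bar>)" for \<omega>
    unfolding set_path by auto
  have [measurable]: "Measurable.pred M (\<lambda>\<omega>. e / 2 * (real (card (X (Suc i) \<omega>)) + 1) \<le> \<bar>toll_tail k (X (Suc i) \<omega>)\<bar>)" for i
    by (rule X_pred)
  have path_pred: "Measurable.pred M (\<lambda>\<omega>. ?P (path n \<omega>))"
    unfolding path_iff by measurable
  then have path_sets: "{\<omega>\<in>space M. ?P (path n \<omega>)} \<in> sets M" by simp
  have path_borel: "(\<lambda>\<omega>. of_bool (?P (path n \<omega>)) :: real) \<in> borel_measurable M"
    by (rule measurable_compose[OF path_pred]) simp
  have "prob ?A \<le> prob {\<omega>\<in>space M. ?P (path n \<omega>)}"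
  proof (rule finite_measure_mono_AE)
    show "AE \<omega> in M. \<omega> \<in> ?A \<longrightarrow> \<omega> \<in> {\<omega>\<in>space M. ?P (path n \<omega>)}"
      using AE_card_X
    proof eventually_elim
      case (elim \<omega>)
      show ?case
      proof
        assume "\<omega> \<in> ?A"
        then obtain i where i: "i \<le> n" "e \<le> \<bar>toll_tail k (X (Suc i) \<omega>) / real (Suc i)\<bar>" and \<omega>: "\<omega> \<in> space M"
          by auto
        then have "e * real (Suc i) \<le> \<bar>toll_tail k (X (Suc i) \<omega>)\<bar>"
          by (simp add: pos_le_divide_eq)
        moreover have "e / 2 * (real (Suc i) + 1) \<le> e * real (Suc i)"
          using assms by (simp add: field_simps)
        ultimately have "e / 2 * (real (card (X (Suc i) \<omega>)) + 1) \<le> \<bar>toll_tail k (X (Suc i) \<omega>)\<bar>"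
          using elim by auto
        then show "\<omega> \<in> {\<omega>\<in>space M. ?P (path n \<omega>)}"
          using i(1) \<omega> unfolding path_iff by auto
      qed
    qed
  qed (rule path_sets)
  also have "prob {\<omega>\<in>space M. ?P (path n \<omega>)} = expectation (\<lambda>\<omega>. of_bool (?P (path n \<omega>)))"
  proof -
    have "expectation (\<lambda>\<omega>. of_bool (?P (path n \<omega>))) =
        expectation (indicator {\<omega>\<in>space M. ?P (path n \<omega>)})"
      by (intro Bochner_Integration.integral_cong refl) (simp add: indicator_def)
    also have "\<dots> = prob {\<omega>\<in>space M. ?P (path n \<omega>)}"
      unfolding Bochner_Integration.integral_indicator by (rule arg_cong[where f = prob]) auto
    finally show ?thesis by (rule sym)
  qed
  also have "\<dots> = path_mean n (\<lambda>p. of_bool (?P p))"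
    by (rule path_expectation(2)[of "\<lambda>p. of_bool (?P p)", OF path_borel])
  finally have "e\<^sup>2 * prob ?A \<le> 4 * ((e / 2)\<^sup>2 * path_mean n (\<lambda>p. of_bool (?P p)))"
    by (simp add: power_divide mult_left_mono)
  also have "\<dots> \<le> 4 * (64 * (2 / 3) ^ k)"
    using assms by (intro mult_left_mono path_mean_toll_tail_maximal) auto
  finally show ?thesis by simp
qed

end

section \<open>Adding the deterministic term and assembling the result\<close>

lemma converges_L2_add_AE:
  assumes "prob_space M"
    and Z: "converges_L2 M Z L" and b: "b \<longlonglongrightarrow> (c :: real)"
    and F: "\<And>n. F n \<in> borel_measurable M" "\<And>n. AE \<omega> in M. F n \<omega> = b n + Z n \<omega>"
  shows "converges_L2 M F (\<lambda>\<omega>. c + L \<omega>)"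
proof -
  interpret prob_space M by fact
  have sqc: "square_integrable M (\<lambda>_. a)" for a by (simp add: square_integrable_def)
  have sq: "square_integrable M (Z n)" "square_integrable M L" for n
    using Z by (auto simp: converges_L2_def)
  have [measurable]: "Z n \<in> borel_measurable M" "L \<in> borel_measurable M" "F n \<in> borel_measurable M" for n
    using sq F(1) by (auto simp: square_integrable_def)
  have sq_d: "square_integrable M (\<lambda>\<omega>. Z n \<omega> - L \<omega>)" for n
    using square_integrable_add[OF sq(1)[of n], of "\<lambda>\<omega>. - L \<omega>"] sq(2) by (simp add: square_integrable_def)
  have F_eq: "(\<integral>\<omega>. (F n \<omega> - a \<omega>)\<^sup>2 \<partial>M) = (\<integral>\<omega>. (b n + Z n \<omega> - a \<omega>)\<^sup>2 \<partial>M)"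
    if [measurable]: "a \<in> borel_measurable M" for n a
    by (rule integral_cong_AE) (use F(2)[of n] in auto)
  have "integrable M (\<lambda>\<omega>. (F n \<omega>)\<^sup>2)" for n
    by (rule integrable_cong_AE_imp[where g = "\<lambda>\<omega>. (b n + Z n \<omega>)\<^sup>2"])
       (use F(2)[of n] square_integrable_add[OF sqc sq(1)[of n]] in \<open>auto simp: square_integrable_def\<close>)
  then have "square_integrable M (F n)" for n using F(1) by (simp add: square_integrable_def)
  moreover have "square_integrable M (\<lambda>\<omega>. c + L \<omega>)"
    by (rule square_integrable_add[OF sqc sq(2)])
  moreover have "(\<lambda>n. \<integral>\<omega>. (F n \<omega> - (c + L \<omega>))\<^sup>2 \<partial>M) \<longlonglongrightarrow> 0"
  proof (rule tendsto_sandwich[OF _ _ tendsto_const])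
    have "(\<lambda>n. 2 * (b n - c)\<^sup>2 + 2 * (\<integral>\<omega>. (Z n \<omega> - L \<omega>)\<^sup>2 \<partial>M)) \<longlonglongrightarrow> 2 * (c - c)\<^sup>2 + 2 * 0"
      using Z by (intro tendsto_intros b) (auto simp: converges_L2_def)
    then show "(\<lambda>n. 2 * (b n - c)\<^sup>2 + 2 * (\<integral>\<omega>. (Z n \<omega> - L \<omega>)\<^sup>2 \<partial>M)) \<longlonglongrightarrow> 0" by simp
    show "\<forall>\<^sub>F n in sequentially. (\<integral>\<omega>. (F n \<omega> - (c + L \<omega>))\<^sup>2 \<partial>M) \<le> 2 * (b n - c)\<^sup>2 + 2 * (\<integral>\<omega>. (Z n \<omega> - L \<omega>)\<^sup>2 \<partial>M)"
    proof (intro always_eventually allI)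
      fix n
      have "(\<integral>\<omega>. (F n \<omega> - (c + L \<omega>))\<^sup>2 \<partial>M) = (\<integral>\<omega>. ((b n - c) + (Z n \<omega> - L \<omega>))\<^sup>2 \<partial>M)"
        by (subst F_eq) (auto simp: algebra_simps)
      also have "\<dots> \<le> 2 * (\<integral>\<omega>. (b n - c)\<^sup>2 \<partial>M) + 2 * (\<integral>\<omega>. (Z n \<omega> - L \<omega>)\<^sup>2 \<partial>M)"
        by (rule square_integrable_integral_add_le[OF sqc sq_d])
      finally show "(\<integral>\<omega>. (F n \<omega> - (c + L \<omega>))\<^sup>2 \<partial>M) \<le> 2 * (b n - c)\<^sup>2 + 2 * (\<integral>\<omega>. (Z n \<omega> - L \<omega>)\<^sup>2 \<partial>M)"
        by (simp add: prob_space)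
    qed
  qed simp
  ultimately show ?thesis by (simp add: converges_L2_def)
qed

theorem theorem6:
  fixes M :: "'a measure"
    and X :: "nat \<Rightarrow> 'a \<Rightarrow> bool list set"
    and Xlim :: "'a \<Rightarrow> bnode measure"
  assumes "prob_space M"
    and "bst_chain M X"
    and "bst_limit M X Xlim"
  shows
    "((AE \<omega> in M. (\<lambda>k. Y_part (Xlim \<omega>) k) \<longlonglongrightarrow> Y_lim (Xlim \<omega>)) \<and>
      converges_L2 M (\<lambda>k \<omega>. Y_part (Xlim \<omega>) k) (\<lambda>\<omega>. Y_lim (Xlim \<omega>))) \<and>
     ((AE \<omega> in M. (\<lambda>n. real (IPL (X n \<omega>)) / real n - 2 * ln (real n))
          \<longlonglongrightarrow> 2 * euler_mascheroni - 4 + Y_lim (Xlim \<omega>)) \<and>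
      converges_L2 M (\<lambda>n \<omega>. real (IPL (X n \<omega>)) / real n - 2 * ln (real n))
        (\<lambda>\<omega>. 2 * euler_mascheroni - 4 + Y_lim (Xlim \<omega>)))"
proof -
  interpret bst_process M X
    using assms(1,2) by (simp add: bst_process_def bst_process_axioms_def)
  have Xlim: "Xlim \<in> measurable M (prob_algebra (restrict_space borel boundary))"
    and conv: "AE \<omega> in M. unif_weakly_converges (\<lambda>n. X n \<omega>) (Xlim \<omega>)"
    using assms(3) by (auto simp: bst_limit_def)
  have [measurable]: "(\<lambda>\<omega>. measure (Xlim \<omega>) (cyl u)) \<in> borel_measurable M" for u
    by (rule measurable_compose[OF Xlim]) (rule measurable_measure_prob_algebra[OF cyl_in_sets])
  let ?A = "\<lambda>k. {u :: bool list. length u \<le> k}"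
  \<comment> \<open>Time is shifted by one because the chain starts at 1 and \<open>X 0\<close> is
    arbitrary.\<close>
  define Z where "Z n \<omega> = (\<Sum>u\<in>X (Suc n) \<omega>. toll (X (Suc n) \<omega>) u) / real (Suc n)" for n \<omega>
  define P where "P k n \<omega> = (\<Sum>u\<in>?A k. toll (X (Suc n) \<omega>) u / real (Suc n))" for k n \<omega>
  define Y where "Y k \<omega> = Y_part (Xlim \<omega>) k" for k \<omega>
  have meas: "Z n \<in> borel_measurable M" "P k n \<in> borel_measurable M" "Y k \<in> borel_measurable M" for k n
  proof -
    show "Z n \<in> borel_measurable M"
      unfolding Z_def by (rule X_borel[of "\<lambda>x. (\<Sum>u\<in>x. toll x u) / real (Suc n)"])
    show "P k n \<in> borel_measurable M"
      unfolding P_def by (rule X_borel[of "\<lambda>x. \<Sum>u\<in>?A k. toll x u / real (Suc n)"])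
    show "Y k \<in> borel_measurable M"
      unfolding Y_def Y_part_def C_def by measurable
  qed
  have Z_minus_P: "Z n \<omega> - P k n \<omega> = toll_tail k (X (Suc n) \<omega>) / real (Suc n)" if "\<omega> \<in> space M" for k n \<omega>
  proof -
    let ?x = "X (Suc n) \<omega>"
    have fin: "finite ?x" using is_treeD(1)[OF is_tree_X[OF that]] .
    have "(\<Sum>u\<in>?x. toll ?x u) = (\<Sum>u\<in>{u\<in>?x. length u \<le> k}. toll ?x u) + toll_tail k ?x"
      unfolding toll_tail_def using fin
      by (subst sum.union_disjoint[symmetric]) (auto intro!: sum.cong)
    also have "(\<Sum>u\<in>{u\<in>?x. length u \<le> k}. toll ?x u) = (\<Sum>u\<in>?A k. toll ?x u)"
      by (rule sum.mono_neutral_left[OF finite_nodes_length_le]) (auto simp: toll_def)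
    finally show ?thesis
      by (simp add: Z_def P_def add_divide_distrib flip: sum_divide_distrib)
  qed
  have P_lim: "AE \<omega> in M. (\<lambda>n. P k n \<omega>) \<longlonglongrightarrow> Y k \<omega>" for k
    using conv AE_card_X AE_space
  proof eventually_elim
    case (elim \<omega>)
    then have x: "\<And>n. 1 \<le> n \<Longrightarrow> is_tree (X n \<omega>) \<and> card (X n \<omega>) = n" by blast
    have "sets (Xlim \<omega>) = sets (restrict_space borel boundary)"
      using measurable_space[OF Xlim, of \<omega>] elim by (simp add: space_prob_algebra)
    note lim = fringe_size_limit[OF elim(1) this x]
    have "(\<lambda>n. toll (X (Suc n) \<omega>) u / real (Suc n)) \<longlonglongrightarrow>
        measure (Xlim \<omega>) (cyl u) * C (measure (Xlim \<omega>) (cyl (u @ [False])) / measure (Xlim \<omega>) (cyl u))" for u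
      by (rule LIMSEQ_Suc[OF toll_limit[of "\<lambda>n. X n \<omega>" "\<lambda>u. measure (Xlim \<omega>) (cyl u)", OF x lim]])
    then show ?case
      unfolding P_def Y_def Y_part_def by (intro tendsto_sum)
  qed
  \<comment> \<open>Each normalised toll is at most 4 in absolute value, since a subtree has at most
    n + 1 nodes.\<close>
  have P_bound: "AE \<omega> in M. \<bar>P k n \<omega>\<bar> \<le> 4 * real (card (?A k))" for k n
    using AE_card_X
  proof eventually_elim
    case (elim \<omega>)
    then have x: "is_tree (X (Suc n) \<omega>)" "card (X (Suc n) \<omega>) = Suc n" by auto
    have "\<bar>toll (X (Suc n) \<omega>) u / real (Suc n)\<bar> \<le> 4" for u
      using abs_toll_le[OF x(1), of u] fringe_size_le[OF is_treeD(1)[OF x(1)], of u] x(2)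
      by (simp add: pos_divide_le_eq)
    then have "\<bar>P k n \<omega>\<bar> \<le> (\<Sum>u\<in>?A k. 4)"
      unfolding P_def by (intro order_trans[OF sum_abs] sum_mono) simp
    then show ?case by simp
  qed
  have error: "integrable M (\<lambda>\<omega>. (Z n \<omega> - P k n \<omega>)\<^sup>2)"
    "expectation (\<lambda>\<omega>. (Z n \<omega> - P k n \<omega>)\<^sup>2) \<le> 256 * (2 / 3) ^ k" for k n
  proof -
    show "integrable M (\<lambda>\<omega>. (Z n \<omega> - P k n \<omega>)\<^sup>2)"
      using expectation_toll_tail(1)[of k n] by (subst Bochner_Integration.integrable_cong[OF refl]) (auto simp: Z_minus_P)
    have "expectation (\<lambda>\<omega>. (Z n \<omega> - P k n \<omega>)\<^sup>2) = expectation (\<lambda>\<omega>. (toll_tail k (X (Suc n) \<omega>) / real (Suc n))\<^sup>2)"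
      by (intro Bochner_Integration.integral_cong refl) (simp add: Z_minus_P)
    then show "expectation (\<lambda>\<omega>. (Z n \<omega> - P k n \<omega>)\<^sup>2) \<le> 256 * (2 / 3) ^ k"
      using expectation_toll_tail(2)[of k n] by simp
  qed
  have maximal: "e\<^sup>2 * prob {\<omega>\<in>space M. \<exists>i\<le>n. e \<le> \<bar>Z i \<omega> - P k i \<omega>\<bar>} \<le> 256 * (2 / 3) ^ k"
    if "0 < e" for e k n
  proof -
    have "{\<omega>\<in>space M. \<exists>i\<le>n. e \<le> \<bar>Z i \<omega> - P k i \<omega>\<bar>} =
        {\<omega>\<in>space M. \<exists>i\<le>n. e \<le> \<bar>toll_tail k (X (Suc i) \<omega>) / real (Suc i)\<bar>}"
      by (intro Collect_cong conj_cong refl) (simp add: Z_minus_P)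
    then show ?thesis using prob_toll_tail_maximal[OF that, of n k] by simp
  qed
  have "summable (\<lambda>k. 256 * (2 / 3 :: real) ^ k)" by (intro summable_mult summable_geometric) simp
  note main = convergence_by_approximation[of Z P Y "\<lambda>k. 4 * real (card (?A k))", OF meas P_lim P_bound this error maximal]
  have Y_lim_eq: "Y_lim (Xlim \<omega>) = lim (\<lambda>k. Y k \<omega>)" for \<omega>
    by (simp add: Y_lim_def Y_def)
  have Y_conv: "AE \<omega> in M. (\<lambda>k. Y_part (Xlim \<omega>) k) \<longlonglongrightarrow> Y_lim (Xlim \<omega>)"
    "converges_L2 M (\<lambda>k \<omega>. Y_part (Xlim \<omega>) k) (\<lambda>\<omega>. Y_lim (Xlim \<omega>))"
    using main(1,3) by (simp_all add: Y_lim_eq Y_def[abs_def])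
  have Z_conv: "AE \<omega> in M. (\<lambda>n. Z n \<omega>) \<longlonglongrightarrow> Y_lim (Xlim \<omega>)"
    "converges_L2 M Z (\<lambda>\<omega>. Y_lim (Xlim \<omega>))"
    using main(2,4) by (simp_all add: Y_lim_eq)
  define b where "b n = mean_IPL n / real n - 2 * ln (real n)" for n
  define F where "F n \<omega> = real (IPL (X n \<omega>)) / real n - 2 * ln (real n)" for n \<omega>
  have b_lim: "(\<lambda>n. b (Suc n)) \<longlonglongrightarrow> 2 * euler_mascheroni - 4"
    using LIMSEQ_Suc[OF mean_IPL_limit] by (simp add: b_def)
  have F_eq: "AE \<omega> in M. \<forall>n. F (Suc n) \<omega> = b (Suc n) + Z n \<omega>"
    using AE_card_X
  proof eventually_elim
    case (elim \<omega>)
    then have "is_tree (X (Suc n) \<omega>)" "card (X (Suc n) \<omega>) = Suc n" for n by auto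
    then show ?case
      by (simp add: F_def b_def Z_def IPL_eq_sum_toll add_divide_distrib)
  qed
  have F_AE: "AE \<omega> in M. (\<lambda>n. F n \<omega>) \<longlonglongrightarrow> 2 * euler_mascheroni - 4 + Y_lim (Xlim \<omega>)"
    using F_eq Z_conv(1)
  proof eventually_elim
    case (elim \<omega>)
    have "(\<lambda>n. F (Suc n) \<omega>) \<longlonglongrightarrow> 2 * euler_mascheroni - 4 + Y_lim (Xlim \<omega>)"
      using tendsto_add[OF b_lim elim(2)] elim(1) by simp
    then show ?case by (rule LIMSEQ_imp_Suc)
  qed
  have "converges_L2 M (\<lambda>n. F (Suc n)) (\<lambda>\<omega>. 2 * euler_mascheroni - 4 + Y_lim (Xlim \<omega>))"
  proof (rule converges_L2_add_AE[OF prob_space_axioms Z_conv(2) b_lim])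
    show "F (Suc n) \<in> borel_measurable M" for n
      unfolding F_def by (rule X_borel[of "\<lambda>x. real (IPL x) / real (Suc n) - 2 * ln (real (Suc n))"])
    show "AE \<omega> in M. F (Suc n) \<omega> = b (Suc n) + Z n \<omega>" for n
      using F_eq by eventually_elim blast
  qed
  \<comment> \<open>\<open>converges_L2\<close> also asks for square integrability at index 0, where
    division by 0 and \<open>ln 0 = 0\<close> make the function 0.\<close>
  moreover have "F 0 = (\<lambda>_. 0)" by (simp add: F_def fun_eq_iff)
  then have "square_integrable M (F n)" if "\<And>n. square_integrable M (F (Suc n))" for n
    using that by (cases n) (simp_all add: square_integrable_def)
  ultimately have "converges_L2 M F (\<lambda>\<omega>. 2 * euler_mascheroni - 4 + Y_lim (Xlim \<omega>))"
    unfolding converges_L2_def by (blast intro: LIMSEQ_imp_Suc)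
  then show ?thesis
    using Y_conv F_AE by (simp add: F_def[abs_def])
qed

end
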